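(* Let $D$ be a binary delta-matroid on a finite set $E$ and let $Z=Z_3(D,\tau)$ with $\tau=(T_1,T_2,T_3)$. Then $D$ is bipartite if and only if $$|C\cap(T_2\cup T_3)|\equiv 0\pmod 2\quad\text{for every circuit } C\text{ of }Z.$$ Equivalently, writing $p_i(C)=|C\cap T_i|\bmod 2$, $D$ is bipartite if and only if $p_2(C)+p_3(C)=0$ in $\mathbb F_2$ for every circuit $C$ of $Z$.
   Context: All sets are finite; $\triangle$ is symmetric difference. Delta-matroids. A set system is a pair $(E,\mathcal F)$ with $\mathcal F\subseteq 2^E$ (the feasible sets). A delta-matroid is a set system $D=(E,\mathcal F)$ with $\mathcal F\ne\varnothing$ such that for all $X,Y\in\mathcal F$ and $u\in X\triangle Y$ there is $v\in X\triangle Y$ (possibly $v=u$) with $X\triangle\{u,v\}\in\mathcal F$. $D_{\min}$ is the matroid on $E$ whose bases are the feasible sets of minimum cardinality; $D$ is bipartite if every circuit of $D_{\min}$ has even cardinality. Twist: $D*X=(E,\{F\triangle X:F\in\mathcal F\})$ for $X\subseteq E$. For a symmetric matrix $A$ over $\mathbb F_2$ indexed by $E$, $D(A)=(E,\{X\subseteq E: A[X]\text{ nonsingular}\})$, where $A[X]$ is the principal submatrix and the empty matrix is nonsingular. $D$ is binary if some twist of $D$ is isomorphic to some such $D(A)$. Multimatroids. A carrier $(U,\Omega)$ is a set $U$ with a partition $\Omega$ into skew classes. A subtransversal (transversal) meets each skew class in at most (exactly) one element. A multimatroid $Z=(U,\Omega,\mathcal I)$ has $\mathcal I$ a family of subtransversals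 (independent sets) such that (1) for each transversal $T$, $\mathcal I\cap 2^T$ is the family of independent sets of a matroid on $T$; (2) for every $I\in\mathcal I$ and every two distinct elements $x,y$ of one skew class disjoint from $I$, $I\cup\{x\}\in\mathcal I$ or $I\cup\{y\}\in\mathcal I$. Bases are the maximal independent sets; circuits are the minimal subtransversals that are not independent. For $X\subseteq U$, $Z-X$ is the multimatroid on $U\setminus X$, with skew classes the nonempty sets $\omega\setminus X$, whose independent sets are those of $Z$ contained in $U\setminus X$. A $3$-matroid is a multimatroid all of whose skew classes have size $3$; it is tight if for every basis $X$ and skew class $\omega$, exactly one of the transversals $(X\setminus\omega)\cup\{u\}$, $u\in\omega$, is not a basis. The tight $3$-matroid $Z_3(D,\tau)$. For each $e\in E$ let $\omega_e=\{e_1,e_2,e_3\}$ (pairwise disjoint), $U=\bigcup_e\omega_e$, $\Omega=\{\omega_e:e\in E\}$, $T_i=\{e_i:e\in E\}$, $\tau=(T_1,T_2,T_3)$. For a tight $3$-matroid $Z$ on $(U,\Omega)$, $D_{Z,\tau}$ is the set system on $E$ in which $X$ is feasible iff $\{e_1:e\in E\setminus X\}\cup\{e_2:e\in X\}$ is a basis of $Z-T_3$. For a binary delta-matroid $D$ it is known that there is a unique tight $3$-matroid $Z$ on $(U,\Omega)$ with $D=D_{Z,\tau}$; it is denoted $Z_3(D,\tau)$. *)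

theory Defs
  imports
    Main
    "HOL-Library.Disjoint_Sets"
    "HOL-Library.Z2"
    "HOL-Combinatorics.Permutations"
begin

section \<open>Set systems, matroids and delta-matroids\<close>

record 'a set_system =
  ground :: "'a set"
  members :: "'a set set"

definition set_system :: "'a set_system \<Rightarrow> bool" where
  "set_system D \<longleftrightarrow> finite (ground D) \<and> members D \<subseteq> Pow (ground D)"

text \<open>A matroid is given by its ground set and its family of independent sets.\<close>

definition matroid :: "'a set_system \<Rightarrow> bool" where
  "matroid M \<longleftrightarrow>
     set_system M \<and>
     {} \<in> members M \<and>
     (\<forall>J\<in>members M. \<forall>I. I \<subseteq> J \<longrightarrow> I \<in> members M) \<and>
     (\<forall>I\<in>members M. \<forall>J\<in>members M. card I < card J \<longrightarrow>
        (\<exists>x\<in>J - I. insert x I \<in> members M))"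

definition matroid_circuits :: "'a set_system \<Rightarrow> 'a set set" where
  "matroid_circuits M =
     {C. C \<subseteq> ground M \<and> C \<notin> members M \<and> (\<forall>C'. C' \<subset> C \<longrightarrow> C' \<in> members M)}"

definition sym_diff_set :: "'a set \<Rightarrow> 'a set \<Rightarrow> 'a set" (infixl \<open>\<triangle>\<close> 65) where
  "X \<triangle> Y = (X - Y) \<union> (Y - X)"

definition delta_matroid :: "'a set_system \<Rightarrow> bool" where
  "delta_matroid D \<longleftrightarrow>
     set_system D \<and> members D \<noteq> {} \<and>
     (\<forall>X\<in>members D. \<forall>Y\<in>members D. \<forall>u\<in>X \<triangle> Y. \<exists>v\<in>X \<triangle> Y. X \<triangle> {u, v} \<in> members D)"

definition min_members :: "'a set_system \<Rightarrow> 'a set set" where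
  "min_members D = {B \<in> members D. \<forall>F\<in>members D. card B \<le> card F}"

definition D_min :: "'a set_system \<Rightarrow> 'a set_system" where
  "D_min D = \<lparr>ground = ground D, members = {I. \<exists>B\<in>min_members D. I \<subseteq> B}\<rparr>"

definition bipartite :: "'a set_system \<Rightarrow> bool" where
  "bipartite D \<longleftrightarrow> (\<forall>C\<in>matroid_circuits (D_min D). even (card C))"

definition twist :: "'a set_system \<Rightarrow> 'a set \<Rightarrow> 'a set_system" where
  "twist D X = \<lparr>ground = ground D, members = (\<lambda>F. F \<triangle> X) ` members D\<rparr>"

definition isomorphic :: "'a set_system \<Rightarrow> 'b set_system \<Rightarrow> bool" where
  "isomorphic D D' \<longleftrightarrow>
     (\<exists>f. bij_betw f (ground D) (ground D') \<and> members D' = (\<lambda>F. f ` F) ` members D)"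

text \<open>
  The determinant (Leibniz formula) of the principal submatrix \<open>A[X]\<close> of a matrix whose rows
  and columns are indexed by a set containing the finite set \<open>X\<close>.
\<close>

definition det_on :: "'a set \<Rightarrow> ('a \<Rightarrow> 'a \<Rightarrow> 'k::comm_ring_1) \<Rightarrow> 'k" where
  "det_on X A = (\<Sum>p | p permutes X. of_int (sign p) * (\<Prod>i\<in>X. A i (p i)))"

definition matrix_system :: "'a set \<Rightarrow> ('a \<Rightarrow> 'a \<Rightarrow> bit) \<Rightarrow> 'a set_system" where
  "matrix_system E A = \<lparr>ground = E, members = {X. X \<subseteq> E \<and> det_on X A \<noteq> 0}\<rparr>"

definition is_binary :: "'a set_system \<Rightarrow> bool" where
  "is_binary D \<longleftrightarrow>
     (\<exists>X\<subseteq>ground D. \<exists>(E :: 'a set) A.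
        finite E \<and> (\<forall>i\<in>E. \<forall>j\<in>E. A i j = A j i) \<and>
        isomorphic (twist D X) (matrix_system E A))"


section \<open>Multimatroids\<close>

record 'b multimatroid =
  carrier :: "'b set"
  skew_classes :: "'b set set"
  indep :: "'b set set"

definition subtransversal :: "'b set \<Rightarrow> 'b set set \<Rightarrow> 'b set \<Rightarrow> bool" where
  "subtransversal U \<Omega> S \<longleftrightarrow> S \<subseteq> U \<and> (\<forall>\<omega>\<in>\<Omega>. card (S \<inter> \<omega>) \<le> 1)"

definition transversal :: "'b set \<Rightarrow> 'b set set \<Rightarrow> 'b set \<Rightarrow> bool" where
  "transversal U \<Omega> T \<longleftrightarrow> T \<subseteq> U \<and> (\<forall>\<omega>\<in>\<Omega>. card (T \<inter> \<omega>) = 1)"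

definition multimatroid :: "'b multimatroid \<Rightarrow> bool" where
  "multimatroid Z \<longleftrightarrow>
     finite (carrier Z) \<and> partition_on (carrier Z) (skew_classes Z) \<and>
     (\<forall>I\<in>indep Z. subtransversal (carrier Z) (skew_classes Z) I) \<and>
     (\<forall>T. transversal (carrier Z) (skew_classes Z) T \<longrightarrow>
        matroid \<lparr>ground = T, members = indep Z \<inter> Pow T\<rparr>) \<and>
     (\<forall>I\<in>indep Z. \<forall>\<omega>\<in>skew_classes Z. \<omega> \<inter> I = {} \<longrightarrow>
        (\<forall>x\<in>\<omega>. \<forall>y\<in>\<omega>. x \<noteq> y \<longrightarrow> insert x I \<in> indep Z \<or> insert y I \<in> indep Z))"

definition bases :: "'b multimatroid \<Rightarrow> 'b set set" where
  "bases Z = {B \<in> indep Z. \<forall>I\<in>indep Z. B \<subseteq> I \<longrightarrow> I = B}"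

definition circuits :: "'b multimatroid \<Rightarrow> 'b set set" where
  "circuits Z =
     {C. subtransversal (carrier Z) (skew_classes Z) C \<and> C \<notin> indep Z \<and>
         (\<forall>C'. subtransversal (carrier Z) (skew_classes Z) C' \<and> C' \<subset> C \<longrightarrow> C' \<in> indep Z)}"

definition delete :: "'b multimatroid \<Rightarrow> 'b set \<Rightarrow> 'b multimatroid" where
  "delete Z X =
     \<lparr>carrier = carrier Z - X,
      skew_classes = {\<omega> - X | \<omega>. \<omega> \<in> skew_classes Z \<and> \<omega> - X \<noteq> {}},
      indep = {I \<in> indep Z. I \<subseteq> carrier Z - X}\<rparr>"

definition three_matroid :: "'b multimatroid \<Rightarrow> bool" where
  "three_matroid Z \<longleftrightarrow> multimatroid Z \<and> (\<forall>\<omega>\<in>skew_classes Z. card \<omega> = 3)"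

definition tight_three_matroid :: "'b multimatroid \<Rightarrow> bool" where
  "tight_three_matroid Z \<longleftrightarrow>
     three_matroid Z \<and>
     (\<forall>X\<in>bases Z. \<forall>\<omega>\<in>skew_classes Z. \<exists>!u. u \<in> \<omega> \<and> (X - \<omega>) \<union> {u} \<notin> bases Z)"


section \<open>The tight 3-matroid of a binary delta-matroid\<close>

text \<open>
  The elements \<open>e\<^sub>1, e\<^sub>2, e\<^sub>3\<close> are \<open>t 1 e, t 2 e, t 3 e\<close>. The labelling \<open>t\<close> carries both the
  indexing of the skew classes by \<open>E\<close> and the transversals \<open>\<tau> = (T\<^sub>1, T\<^sub>2, T\<^sub>3)\<close>; it therefore
  takes the place of \<open>\<tau>\<close> as a parameter. Only the indices 1, 2, 3 are relevant.
\<close>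

definition labelling :: "'a set \<Rightarrow> (nat \<Rightarrow> 'a \<Rightarrow> 'b) \<Rightarrow> bool" where
  "labelling E t \<longleftrightarrow> inj_on (\<lambda>(i, e). t i e) ({1, 2, 3} \<times> E)"

definition skew_class :: "(nat \<Rightarrow> 'a \<Rightarrow> 'b) \<Rightarrow> 'a \<Rightarrow> 'b set" where
  "skew_class t e = {t 1 e, t 2 e, t 3 e}"

definition T_set :: "'a set \<Rightarrow> (nat \<Rightarrow> 'a \<Rightarrow> 'b) \<Rightarrow> nat \<Rightarrow> 'b set" where
  "T_set E t i = t i ` E"

definition D_of :: "'a set \<Rightarrow> (nat \<Rightarrow> 'a \<Rightarrow> 'b) \<Rightarrow> 'b multimatroid \<Rightarrow> 'a set_system" where
  "D_of E t Z =
     \<lparr>ground = E,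
      members = {X. X \<subseteq> E \<and> t 1 ` (E - X) \<union> t 2 ` X \<in> bases (delete Z (T_set E t 3))}\<rparr>"

text \<open>
  For a binary delta-matroid \<open>D\<close> and a labelling \<open>t\<close> of its ground set, exactly one \<open>Z\<close>
  satisfies the description below.
\<close>

definition Z3 :: "'a set_system \<Rightarrow> (nat \<Rightarrow> 'a \<Rightarrow> 'b) \<Rightarrow> 'b multimatroid" where
  "Z3 D t =
     (THE Z. tight_three_matroid Z \<and>
        carrier Z = (\<Union>e\<in>ground D. skew_class t e) \<and>
        skew_classes Z = skew_class t ` ground D \<and>
        D_of (ground D) t Z = D)"

definition parity :: "'a set \<Rightarrow> (nat \<Rightarrow> 'a \<Rightarrow> 'b) \<Rightarrow> nat \<Rightarrow> 'b set \<Rightarrow> bit" where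
  "parity E t i C = of_nat (card (C \<inter> T_set E t i))"

end

theory Submission
  imports Defs "Jordan_Normal_Form.Determinant"
begin

text \<open>
  A subtransversal \<open>C\<close> is a vector of \<open>K\<^sup>E\<close> for the Klein four-group \<open>K\<close>: the entry at \<open>e\<close> is \<open>0\<close> if
  \<open>C\<close> misses the class of \<open>e\<close>, and otherwise \<open>(1,0)\<close>, \<open>(0,1)\<close> or \<open>(1,1)\<close> according to which of
  \<open>e\<^sub>1\<close>, \<open>e\<^sub>2\<close>, \<open>e\<^sub>3\<close> it contains. Reading the two coordinates separately, such a vector is a pair
  \<open>(p, q)\<close> of subsets of \<open>E\<close>, added by symmetric difference. The number \<open>|C \<inter> (T\<^sub>2 \<union> T\<^sub>3)|\<close> of the
  theorem is \<open>|q|\<close>.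

  Everything about a binary delta-matroid \<open>D\<close> is stored in one Lagrangian subspace \<open>L\<close> of this
  symplectic space: for \<open>D = D(A)\<close> it is the graph \<open>{(A q, q)}\<close>, and twisting by \<open>X\<close> exchanges the
  coordinates on \<open>X\<close> (\<open>binary_lagrangian\<close>). A set \<open>F\<close> is feasible iff no nonzero \<open>(p, q) \<in> L\<close> has
  \<open>p \<subseteq> E - F\<close> and \<open>q \<subseteq> F\<close>.

  The 3-matroid \<open>Z\<^sub>3(D, \<tau>)\<close> has as independent sets the subtransversals above no nonzero vector of
  \<open>L\<close>. Two vectors of \<open>L\<close> cannot have different nonzero entries in exactly one class, because
  \<open>L\<close> is isotropic; this is the multimatroid axiom, and it bounds the number of non-bases in a class
  by one. Because \<open>|L| = 2\<^bsup>|E|\<^esup>\<close>, there is always such a non-basis; this is tightness (\<open>tight_Z_of\<close>).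
  Since \<open>Z\<^sub>3(D, \<tau>)\<close> is introduced by a definite description, uniqueness is needed too: tightness
  expresses whether a transversal containing \<open>e\<^sub>3\<close> is a basis through the two transversals with
  \<open>e\<^sub>1\<close> and \<open>e\<^sub>2\<close> instead, so the bases avoiding \<open>T\<^sub>3\<close> determine all others
  (\<open>tight_three_matroid_unique\<close>).

  The circuits of \<open>Z\<^sub>3(D, \<tau>)\<close> are therefore the minimal nonzero vectors of \<open>L\<close>. On the other side, the
  circuits of \<open>D\<^sub>m\<^sub>i\<^sub>n\<close> are the minimal nonempty members of the projection \<open>{q. (p, q) \<in> L}\<close>
  (\<open>subset_min_feasible_iff\<close>): \<open>D\<^sub>m\<^sub>i\<^sub>n\<close> is dual to the binary matroid with cycle space \<open>{p. (p, {}) \<in> L}\<close>,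
  whose orthogonal complement is that projection. In both spaces every vector is a disjoint union
  of minimal ones, so both sides of the theorem say that \<open>|q|\<close> is even for every \<open>(p, q) \<in> L\<close>.
\<close>

section \<open>Sets as vectors over the field with two elements\<close>

(* Addition and multiplication of bits are kept as ring operations, and the index 1 of a label is
   not rewritten to a successor term. *)
declare add_bit_eq_xor [simp del] mult_bit_eq_and [simp del] One_nat_def [simp del]

lemma in_sym_diff [simp]: "x \<in> X \<triangle> Y \<longleftrightarrow> (x \<in> X) \<noteq> (x \<in> Y)"
  by (auto simp: sym_diff_set_def)

lemma sym_diff_cancel: "X \<triangle> Y \<triangle> Y = X"
  by (auto simp: sym_diff_set_def)

lemma sym_diff_subset: "X \<subseteq> Z \<Longrightarrow> Y \<subseteq> Z \<Longrightarrow> X \<triangle> Y \<subseteq> Z"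
  by auto

lemma finite_sym_diff [simp]: "finite X \<Longrightarrow> finite Y \<Longrightarrow> finite (X \<triangle> Y)"
  by (simp add: sym_diff_set_def)

lemma bit_add_self [simp]: "x + x = (0::bit)"
  by (cases x) simp_all

lemma bit_add_eq_0_iff: "x + y = 0 \<longleftrightarrow> x = y" for x y :: bit
  by (cases x; cases y) simp_all

lemma of_nat_bit_eq_0_iff: "(of_nat n :: bit) = 0 \<longleftrightarrow> even n"
  by (induction n) (auto simp: bit_add_eq_0_iff)

lemma sum_sym_diff_bit:
  fixes f :: "'a \<Rightarrow> bit"
  assumes "finite X" "finite Y"
  shows "sum f (X \<triangle> Y) = sum f X + sum f Y"
proof -
  have "sum f X = sum f (X - Y) + sum f (X \<inter> Y)" "sum f Y = sum f (Y - X) + sum f (X \<inter> Y)"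
    using assms by (metis add.commute sum.Int_Diff) (metis assms(2) Int_commute add.commute sum.Int_Diff)
  moreover have "sum f (X \<triangle> Y) = sum f (X - Y) + sum f (Y - X)"
    unfolding sym_diff_set_def using assms by (intro sum.union_disjoint) auto
  ultimately show ?thesis
    by (metis (no_types) add.assoc add.commute add.right_neutral bit_add_self)
qed

lemma even_card_iff: "even (card S) \<longleftrightarrow> (\<Sum>i\<in>S. 1::bit) = 0"
  by (simp add: of_nat_bit_eq_0_iff)

text \<open>
  When independence means containing no nonempty member of a family, the circuits are the minimal
  nonempty members of the family. This covers both the circuits of a matroid, where \<open>S\<close> consists of
  all subsets of the ground set, and those of a multimatroid, where \<open>S\<close> consists of the
  subtransversals.
\<close>

lemma minimal_dependent_eq_minimal_members:
  fixes N S \<I> :: "'a set set"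
  assumes down: "\<And>A B. A \<in> S \<Longrightarrow> B \<subseteq> A \<Longrightarrow> B \<in> S"
    and N: "N \<subseteq> S"
    and indep: "\<And>I. I \<in> S \<Longrightarrow> I \<in> \<I> \<longleftrightarrow> (\<forall>A\<in>N. A \<subseteq> I \<longrightarrow> A = {})"
  shows "{C \<in> S. C \<notin> \<I> \<and> (\<forall>C'\<in>S. C' \<subset> C \<longrightarrow> C' \<in> \<I>)} =
    {A \<in> N. A \<noteq> {} \<and> (\<forall>B\<in>N. B \<subset> A \<longrightarrow> B = {})}" (is "?L = ?R")
proof
  show "?L \<subseteq> ?R"
  proof
    fix C assume "C \<in> ?L"
    then have C: "C \<in> S" "C \<notin> \<I>" and proper: "\<And>C'. C' \<in> S \<Longrightarrow> C' \<subset> C \<Longrightarrow> C' \<in> \<I>"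
      by auto
    have min: "B = {}" if "B \<in> N" "B \<subset> C" for B
      using proper[of B] indep[of B] that N by blast
    obtain A where "A \<in> N" "A \<subseteq> C" "A \<noteq> {}" using indep[OF C(1)] C(2) by blast
    moreover from this have "A = C" using min by blast
    ultimately show "C \<in> ?R" using min by blast
  qed
next
  show "?R \<subseteq> ?L"
  proof
    fix C assume "C \<in> ?R"
    then have C: "C \<in> N" "C \<noteq> {}" and min: "\<And>B. B \<in> N \<Longrightarrow> B \<subset> C \<Longrightarrow> B = {}"
      by auto
    have CS: "C \<in> S" using C(1) N by blast
    have "C \<notin> \<I>" using indep[OF CS] C by blast
    moreover have "C' \<in> \<I>" if "C' \<in> S" "C' \<subset> C" for C'
      using indep[OF that(1)] that(2) min by blast
    ultimately show "C \<in> ?L" using CS by blast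
  qed
qed

text \<open>
  Splitting off a smaller member leaves a member, so by induction every member is a disjoint union
  of minimal ones, and parities add up.
\<close>

lemma minimal_members_even_iff:
  fixes N :: "'a set set"
  assumes fin: "\<And>A. A \<in> N \<Longrightarrow> finite A"
    and diff: "\<And>A B. A \<in> N \<Longrightarrow> B \<in> N \<Longrightarrow> B \<subset> A \<Longrightarrow> A - B \<in> N"
  shows "(\<forall>A\<in>N. A \<noteq> {} \<and> (\<forall>B\<in>N. B \<subset> A \<longrightarrow> B = {}) \<longrightarrow> even (card (A \<inter> W))) \<longleftrightarrow>
    (\<forall>A\<in>N. even (card (A \<inter> W)))"
proof
  assume min: "\<forall>A\<in>N. A \<noteq> {} \<and> (\<forall>B\<in>N. B \<subset> A \<longrightarrow> B = {}) \<longrightarrow> even (card (A \<inter> W))"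
  have "A \<in> N \<Longrightarrow> even (card (A \<inter> W))" if "finite A" for A
    using that
  proof (induction A rule: finite_psubset_induct)
    case (psubset A)
    show ?case
    proof (cases "A \<noteq> {} \<and> (\<forall>B\<in>N. B \<subset> A \<longrightarrow> B = {})")
      case True
      then show ?thesis using min psubset.prems by blast
    next
      case False
      then consider "A = {}" | B where "B \<in> N" "B \<subset> A" "B \<noteq> {}" by blast
      then show ?thesis
      proof cases
        case 2
        have "even (card (B \<inter> W))" "even (card ((A - B) \<inter> W))"
          using psubset.IH[of B] psubset.IH[of "A - B"] 2 diff[OF psubset.prems] by blast+
        moreover have "A \<inter> W = (B \<inter> W) \<union> ((A - B) \<inter> W)" using 2 by blast
        moreover have "card \<dots> = card (B \<inter> W) + card ((A - B) \<inter> W)"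
          using psubset.hyps 2 by (intro card_Un_disjoint) (auto intro: finite_subset)
        ultimately show ?thesis by simp
      qed simp
    qed
  qed
  then show "\<forall>A\<in>N. even (card (A \<inter> W))" using fin by blast
qed blast

text \<open>
  The exchange axiom for a binary matroid given by its cycle space \<open>N\<close>. If no element of \<open>J - I\<close> could
  be added to \<open>I\<close>, every subset of \<open>J\<close> would be congruent modulo \<open>N\<close> to a subset of \<open>I\<close>. As \<open>J\<close> has more
  subsets than \<open>I\<close>, two of them would be congruent to the same one, and their difference would be a
  nonempty member of \<open>N\<close> inside \<open>J\<close>.
\<close>

lemma binary_exchange:
  fixes N :: "'b set set"
  assumes zero: "{} \<in> N" and add: "\<And>A B. A \<in> N \<Longrightarrow> B \<in> N \<Longrightarrow> A \<triangle> B \<in> N"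
    and fin: "finite I" "finite J" and card: "card I < card J"
    and I: "\<forall>A\<in>N. A \<subseteq> I \<longrightarrow> A = {}" and J: "\<forall>A\<in>N. A \<subseteq> J \<longrightarrow> A = {}"
  shows "\<exists>x\<in>J - I. \<forall>A\<in>N. A \<subseteq> insert x I \<longrightarrow> A = {}"
proof (rule ccontr)
  assume none: "\<not> ?thesis"
  have dep: "\<exists>C\<in>N. C \<subseteq> insert x I \<and> x \<in> C" if x: "x \<in> J - I" for x
  proof -
    obtain C where C: "C \<in> N" "C \<subseteq> insert x I" "C \<noteq> {}" using none x by meson
    then have "\<not> C \<subseteq> I" using I by meson
    then show ?thesis using C by blast
  qed
  have "\<exists>I'\<subseteq>I. J' \<triangle> I' \<in> N" if "finite J'" "J' \<subseteq> J" for J'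
    using that
  proof (induction J')
    case empty
    then show ?case using zero by (intro exI[of _ "{}"]) (simp add: sym_diff_set_def)
  next
    case (insert x J')
    then obtain I' where I': "I' \<subseteq> I" "J' \<triangle> I' \<in> N" by blast
    show ?case
    proof (cases "x \<in> I")
      case True
      have "insert x J' \<triangle> (I' \<triangle> {x}) = J' \<triangle> I'"
        using insert.hyps by (auto simp: sym_diff_set_def)
      then show ?thesis using I' True by (intro exI[of _ "I' \<triangle> {x}"]) (auto simp: sym_diff_set_def)
    next
      case False
      then obtain C where C: "C \<in> N" "C \<subseteq> insert x I" "x \<in> C" using dep insert.prems by blast
      have "x \<notin> I'" using False I' by blast
      then have "insert x J' \<triangle> (I' \<triangle> (C - {x})) = (J' \<triangle> I') \<triangle> C"
        using insert.hyps C(3) by (auto simp: sym_diff_set_def)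
      moreover have "I' \<triangle> (C - {x}) \<subseteq> I" using I'(1) C(2) by (auto simp: sym_diff_set_def)
      ultimately show ?thesis using add[OF I'(2) C(1)] by metis
    qed
  qed
  then have "\<forall>J'\<in>Pow J. \<exists>I'. I' \<subseteq> I \<and> J' \<triangle> I' \<in> N"
    using fin(2) finite_subset by blast
  then obtain g where g: "\<And>J'. J' \<in> Pow J \<Longrightarrow> g J' \<subseteq> I \<and> J' \<triangle> g J' \<in> N"
    using bchoice[of "Pow J"] by metis
  have "card (Pow I) < card (Pow J)" using fin card by (simp add: card_Pow)
  moreover have "g ` Pow J \<subseteq> Pow I" using g by blast
  ultimately have "\<not> inj_on g (Pow J)"
    using card_inj_on_le[of g "Pow J" "Pow I"] fin(1) by fastforce
  then obtain A B where AB: "A \<in> Pow J" "B \<in> Pow J" "A \<noteq> B" "g A = g B"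
    unfolding inj_on_def by blast
  have "(A \<triangle> g A) \<triangle> (B \<triangle> g B) = A \<triangle> B" using AB(4) by (auto simp: sym_diff_set_def)
  then have "A \<triangle> B \<in> N" using add g AB(1,2) by metis
  then have "A \<triangle> B = {}" using J AB(1,2) sym_diff_subset[of A J B] by blast
  then show False using AB(3) by (auto simp: sym_diff_set_def)
qed

section \<open>Principal minors and kernels over the field with two elements\<close>

text \<open>
  The product of the matrix with the indicator vector of \<open>q\<close>, again as a set.
\<close>

definition mat_image :: "'a set \<Rightarrow> ('a \<Rightarrow> 'a \<Rightarrow> bit) \<Rightarrow> 'a set \<Rightarrow> 'a set" where
  "mat_image E A q = {i\<in>E. (\<Sum>j\<in>q. A i j) \<noteq> 0}"

lemma of_int_sign_bit: "(of_int (sign p) :: bit) = 1"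
  by (cases "evenperm p") (simp_all add: sign_def)

lemma det_on_reindex:
  fixes A :: "'b \<Rightarrow> 'b \<Rightarrow> bit"
  assumes f: "bij_betw f X Y"
  shows "det_on Y A = det_on X (\<lambda>i j. A (f i) (f j))"
proof -
  let ?h = "\<lambda>\<pi> x. if x \<in> Y then f (\<pi> (inv_into X f x)) else x"
  have "det_on Y A = (\<Sum>p | p permutes Y. \<Prod>i\<in>Y. A i (p i))"
    by (simp add: det_on_def of_int_sign_bit)
  also have "\<dots> = (\<Sum>p | p permutes X. \<Prod>i\<in>Y. A i (?h p i))"
    by (rule sum.reindex_bij_betw[OF bij_betw_permutations[OF f], symmetric])
  also have "\<dots> = (\<Sum>p | p permutes X. \<Prod>i\<in>X. A (f i) (f (p i)))"
  proof (intro sum.cong refl)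
    fix p assume "p \<in> {p. p permutes X}"
    have "(\<Prod>i\<in>Y. A i (?h p i)) = (\<Prod>i\<in>X. A (f i) (?h p (f i)))"
      by (rule prod.reindex_bij_betw[OF f, symmetric])
    also have "\<dots> = (\<Prod>i\<in>X. A (f i) (f (p i)))"
      using f by (intro prod.cong refl) (auto simp: bij_betw_def)
    finally show "(\<Prod>i\<in>Y. A i (?h p i)) = (\<Prod>i\<in>X. A (f i) (f (p i)))" .
  qed
  also have "\<dots> = det_on X (\<lambda>i j. A (f i) (f j))"
    by (simp add: det_on_def of_int_sign_bit)
  finally show ?thesis .
qed

lemma det_on_atLeastLessThan:
  fixes A :: "nat \<Rightarrow> nat \<Rightarrow> bit"
  shows "det_on {0..<n} A = det (mat n n (\<lambda>(i, j). A i j))"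
  unfolding det_on_def det_def
  by (auto simp: of_int_sign_bit intro!: sum.cong prod.cong dest: permutes_in_image)

lemma det_on_atLeastLessThan_eq_0_iff:
  fixes A :: "nat \<Rightarrow> nat \<Rightarrow> bit"
  shows "det_on {0..<n} A = 0 \<longleftrightarrow>
    (\<exists>q\<subseteq>{0..<n}. q \<noteq> {} \<and> (\<forall>i\<in>{0..<n}. (\<Sum>j\<in>q. A i j) = 0))"
proof -
  let ?M = "mat n n (\<lambda>(i, j). A i j)"
  let ?v = "\<lambda>q. vec n (\<lambda>j. of_bool (j \<in> q) :: bit)"
  have mult: "(?M *\<^sub>v ?v q) $ i = (\<Sum>j\<in>q. A i j)" if "q \<subseteq> {0..<n}" "i < n" for q i
  proof -
    have "(?M *\<^sub>v ?v q) $ i = (\<Sum>j\<in>{0..<n}. A i j * of_bool (j \<in> q))"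
      using that by (auto simp: scalar_prod_def intro!: sum.cong)
    also have "\<dots> = (\<Sum>j\<in>{0..<n}. if j \<in> q then A i j else 0)"
      by (intro sum.cong) auto
    also have "\<dots> = (\<Sum>j\<in>{0..<n} \<inter> q. A i j)"
      by (rule sum.inter_restrict[symmetric]) simp
    also have "{0..<n} \<inter> q = q" using that by auto
    finally show ?thesis .
  qed
  have "det_on {0..<n} A = 0 \<longleftrightarrow> (\<exists>v\<in>carrier_vec n. v \<noteq> 0\<^sub>v n \<and> ?M *\<^sub>v v = 0\<^sub>v n)"
    unfolding det_on_atLeastLessThan by (subst det_0_iff_vec_prod_zero[of _ n]) auto
  also have "\<dots> \<longleftrightarrow> (\<exists>q\<subseteq>{0..<n}. q \<noteq> {} \<and> (\<forall>i\<in>{0..<n}. (\<Sum>j\<in>q. A i j) = 0))"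
  proof
    assume "\<exists>v\<in>carrier_vec n. v \<noteq> 0\<^sub>v n \<and> ?M *\<^sub>v v = 0\<^sub>v n"
    then obtain v where v: "v \<in> carrier_vec n" "v \<noteq> 0\<^sub>v n" "?M *\<^sub>v v = 0\<^sub>v n" by blast
    let ?q = "{j\<in>{0..<n}. v $ j \<noteq> 0}"
    have veq: "v = ?v ?q" using v(1) by (intro eq_vecI) auto
    have "?q \<noteq> {}"
      using v(1,2) by (auto intro!: eq_vecI)
    moreover have "(\<Sum>j\<in>?q. A i j) = 0" if "i \<in> {0..<n}" for i
    proof -
      have "(\<Sum>j\<in>?q. A i j) = (?M *\<^sub>v ?v ?q) $ i"
        using that by (intro mult[symmetric]) auto
      also have "\<dots> = (?M *\<^sub>v v) $ i" using veq by (rule arg_cong[OF sym])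
      also have "\<dots> = 0" using that by (simp only: v(3)) simp
      finally show ?thesis .
    qed
    ultimately show "\<exists>q\<subseteq>{0..<n}. q \<noteq> {} \<and> (\<forall>i\<in>{0..<n}. (\<Sum>j\<in>q. A i j) = 0)"
      by (intro exI[of _ ?q]) auto
  next
    assume "\<exists>q\<subseteq>{0..<n}. q \<noteq> {} \<and> (\<forall>i\<in>{0..<n}. (\<Sum>j\<in>q. A i j) = 0)"
    then obtain q where q: "q \<subseteq> {0..<n}" "q \<noteq> {}" "\<And>i. i \<in> {0..<n} \<Longrightarrow> (\<Sum>j\<in>q. A i j) = 0"
      by blast
    then obtain j where j: "j \<in> q" "j < n" by fastforce
    then have "?v q $ j \<noteq> 0\<^sub>v n $ j" by simp
    then have "?v q \<noteq> 0\<^sub>v n" by metis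
    moreover have "?M *\<^sub>v ?v q = 0\<^sub>v n"
      using mult[OF q(1)] q(3) by (intro eq_vecI) (simp_all del: index_mult_mat_vec)
    ultimately show "\<exists>v\<in>carrier_vec n. v \<noteq> 0\<^sub>v n \<and> ?M *\<^sub>v v = 0\<^sub>v n"
      by (intro bexI[of _ "?v q"]) auto
  qed
  finally show ?thesis .
qed

text \<open>
  Singularity of a principal submatrix in terms of its kernel. The sign of a permutation is trivial
  modulo 2, so the Leibniz formula does not depend on how the index set is ordered, and the matrix
  may be indexed by an initial segment of the natural numbers.
\<close>

lemma det_on_eq_0_iff:
  fixes A :: "'a \<Rightarrow> 'a \<Rightarrow> bit"
  assumes "finite X"
  shows "det_on X A = 0 \<longleftrightarrow> (\<exists>q\<subseteq>X. q \<noteq> {} \<and> mat_image X A q = {})"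
proof -
  obtain f where f: "bij_betw f {0..<card X} X"
    using ex_bij_betw_nat_finite[OF assms] by blast
  then have inj: "inj_on f {0..<card X}" and im: "f ` {0..<card X} = X"
    by (auto simp: bij_betw_def)
  have s: "(\<Sum>j\<in>f ` q. A i j) = (\<Sum>j\<in>q. A i (f j))" if "q \<subseteq> {0..<card X}" for q i
    using that inj by (subst sum.reindex) (auto intro: inj_on_subset)
  show ?thesis
    unfolding det_on_reindex[OF f] det_on_atLeastLessThan_eq_0_iff
    unfolding mat_image_def
  proof (intro iffI; elim exE conjE)
    fix q assume q: "q \<subseteq> {0..<card X}" "q \<noteq> {}"
      "\<forall>i\<in>{0..<card X}. (\<Sum>j\<in>q. A (f i) (f j)) = 0"
    show "\<exists>q\<subseteq>X. q \<noteq> {} \<and> {i \<in> X. sum (A i) q \<noteq> 0} = {}"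
    proof -
      have "sum (A i) (f ` q) = 0" if "i \<in> X" for i
      proof -
        have "i \<in> f ` {0..<card X}" using that im by simp
        then obtain k where "k \<in> {0..<card X}" "i = f k" by (rule imageE)
        then show ?thesis by (simp only: s[OF q(1)] q(3))
      qed
      then have "{i \<in> X. sum (A i) (f ` q) \<noteq> 0} = {}" by blast
      moreover have "f ` q \<subseteq> X" using image_mono[OF q(1), of f] by (simp only: im)
      moreover have "f ` q \<noteq> {}" using q(2) by simp
      ultimately show ?thesis by (intro exI[of _ "f ` q"] conjI)
    qed
  next
    fix q assume q: "q \<subseteq> X" "q \<noteq> {}" "{i \<in> X. sum (A i) q \<noteq> 0} = {}"
    have "q \<subseteq> f ` {0..<card X}" by (simp only: im q(1))
    then obtain q' where q': "q' \<subseteq> {0..<card X}" "q = f ` q'" by (rule subset_imageE)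
    show "\<exists>q\<subseteq>{0..<card X}. q \<noteq> {} \<and> (\<forall>i\<in>{0..<card X}. (\<Sum>j\<in>q. A (f i) (f j)) = 0)"
    proof (intro exI[of _ q'] conjI ballI)
      fix i assume "i \<in> {0..<card X}"
      then have "f i \<in> X" using bij_betwE[OF f] by blast
      then have "sum (A (f i)) q = 0" using q(3) by blast
      then show "(\<Sum>j\<in>q'. A (f i) (f j)) = 0" by (simp only: q'(2) s[OF q'(1)])
    qed (use q' q(2) in auto)
  qed
qed

section \<open>Lagrangian subspaces and the delta-matroid that they carry\<close>

text \<open>
  A pair \<open>(p, q)\<close> stands for the vector with coordinates \<open>p\<close> and \<open>q\<close>, and \<open>|p \<inter> q'| + |q \<inter> p'|\<close> modulo 2
  is the symplectic form. Writing the form as the cardinality of a symmetric difference makes its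
  invariance under exchanging coordinates an equality of sets. An isotropic subspace is Lagrangian
  exactly if it has half the dimension of the whole space, which is recorded by its cardinality.
\<close>

locale lagrangian =
  fixes E :: "'a set" and L :: "('a set \<times> 'a set) set"
  assumes finite_E: "finite E"
    and L_subset: "L \<subseteq> Pow E \<times> Pow E"
    and L_zero: "({}, {}) \<in> L"
    and L_add: "(p, q) \<in> L \<Longrightarrow> (p', q') \<in> L \<Longrightarrow> (p \<triangle> p', q \<triangle> q') \<in> L"
    and L_isotropic: "(p, q) \<in> L \<Longrightarrow> (p', q') \<in> L \<Longrightarrow> even (card ((p \<inter> q') \<triangle> (q \<inter> p')))"
    and card_L: "card L = 2 ^ card E"
begin

text \<open>
  \<open>L\<close> has \<open>2\<^bsup>|E|\<^esup>\<close> cosets, so among more than \<open>2\<^bsup>|E|\<^esup>\<close> vectors two lie in the same coset. All uses of the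
  maximality of \<open>L\<close> go through this count.
\<close>

lemma two_vectors_differ_in_L:
  assumes fin: "finite S"
    and g: "\<And>x. x \<in> S \<Longrightarrow> g x \<subseteq> E \<and> h x \<subseteq> E"
    and big: "card S > 2 ^ card E"
  obtains x y where "x \<in> S" "y \<in> S" "x \<noteq> y" "(g x \<triangle> g y, h x \<triangle> h y) \<in> L"
proof -
  let ?f = "\<lambda>(x, p, q). (g x \<triangle> p, h x \<triangle> q)"
  have "?f ` (S \<times> L) \<subseteq> Pow E \<times> Pow E"
  proof (rule image_subsetI)
    fix z assume "z \<in> S \<times> L"
    then obtain x p q where z: "z = (x, p, q)" "x \<in> S" "(p, q) \<in> L" by auto
    then have "p \<subseteq> E" "q \<subseteq> E" using L_subset by auto
    then show "?f z \<in> Pow E \<times> Pow E"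
      using z g[OF z(2)] by (simp add: sym_diff_subset)
  qed
  moreover have "card (Pow E \<times> Pow E) < card (S \<times> L)"
    using big finite_E by (simp add: card_cartesian_product card_Pow card_L)
  moreover have "finite (Pow E \<times> Pow E)" using finite_E by simp
  ultimately have "\<not> inj_on ?f (S \<times> L)"
    using card_inj_on_le[of ?f "S \<times> L" "Pow E \<times> Pow E"] by linarith
  then obtain a b where ab: "a \<in> S \<times> L" "b \<in> S \<times> L" "a \<noteq> b" "?f a = ?f b"
    unfolding inj_on_def by blast
  obtain x p q y p' q' where a: "a = (x, p, q)" and b: "b = (y, p', q')"
    by (metis prod_cases3)
  from ab have *: "x \<in> S" "y \<in> S" "(p, q) \<in> L" "(p', q') \<in> L"
    "(x, p, q) \<noteq> (y, p', q')" "g x \<triangle> p = g y \<triangle> p'" "h x \<triangle> q = h y \<triangle> q'"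
    by (simp_all add: a b)
  from *(6,7) have eqs: "g x \<triangle> g y = p \<triangle> p'" "h x \<triangle> h y = q \<triangle> q'"
    by (auto simp: set_eq_iff)
  have "x \<noteq> y"
  proof
    assume "x = y"
    then have "p \<triangle> p' = {}" "q \<triangle> q' = {}" using eqs by (auto simp: set_eq_iff)
    then show False using *(5) \<open>x = y\<close> by (auto simp: set_eq_iff)
  qed
  with * eqs L_add[OF *(3,4)] that show thesis by metis
qed

text \<open>
  The vectors \<open>(c, {})\<close> of \<open>L\<close> are the cycles of the matroid dual to \<open>D\<^sub>m\<^sub>i\<^sub>n\<close>; they are orthogonal to every
  second coordinate.
\<close>

lemma even_card_Int_L:
  assumes "(c, {}) \<in> L" "(p, q) \<in> L"
  shows "even (card (c \<inter> q))"
  using L_isotropic[OF assms] by (simp add: sym_diff_set_def)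

definition feasible :: "'a set \<Rightarrow> bool" where
  "feasible F \<longleftrightarrow> F \<subseteq> E \<and> (\<forall>(p, q)\<in>L. p \<inter> F = {} \<and> q \<subseteq> F \<longrightarrow> p = {} \<and> q = {})"

lemma feasibleI:
  assumes "F \<subseteq> E"
    and "\<And>p q. (p, q) \<in> L \<Longrightarrow> p \<inter> F = {} \<Longrightarrow> q \<subseteq> F \<Longrightarrow> p = {} \<and> q = {}"
  shows "feasible F"
  using assms unfolding feasible_def by blast

lemma feasibleD:
  "feasible F \<Longrightarrow> (p, q) \<in> L \<Longrightarrow> p \<inter> F = {} \<Longrightarrow> q \<subseteq> F \<Longrightarrow> p = {} \<and> q = {}"
  unfolding feasible_def by blast

lemma feasible_subset: "feasible X \<Longrightarrow> X \<subseteq> E"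
  by (simp add: feasible_def)

definition min_feasible :: "'a set \<Rightarrow> bool" where
  "min_feasible B \<longleftrightarrow> feasible B \<and> (\<forall>F. feasible F \<longrightarrow> card B \<le> card F)"

text \<open>
  A complement \<open>B\<close> of a basis of the cycle matroid is feasible: if \<open>(p, q) \<in> L\<close> with \<open>q \<subseteq> B\<close>, an element
  \<open>b \<in> q\<close> would be the only common element of \<open>q\<close> and the fundamental cycle of \<open>b\<close>, against
  orthogonality.
\<close>

lemma feasible_if_fundamental:
  assumes "B \<subseteq> E"
    and fund: "\<And>b. b \<in> B \<Longrightarrow> \<exists>c. (c, {}) \<in> L \<and> c \<inter> B = {b}"
    and free: "\<And>p. (p, {}) \<in> L \<Longrightarrow> p \<inter> B = {} \<Longrightarrow> p = {}"
  shows "feasible B"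
proof (rule feasibleI[OF assms(1)])
  fix p q assume pq: "(p, q) \<in> L" and *: "p \<inter> B = {}" "q \<subseteq> B"
  have "q = {}"
  proof (rule ccontr)
    assume "q \<noteq> {}"
    then obtain b where b: "b \<in> q" by blast
    then obtain c where c: "(c, {}) \<in> L" "c \<inter> B = {b}" using fund *(2) by blast
    have "c \<inter> q = {b}" using b c(2) *(2) by blast
    then show False using even_card_Int_L[OF c(1) pq] by simp
  qed
  then show "p = {} \<and> q = {}" using free pq * by blast
qed

text \<open>
  Feasibility makes \<open>E - B\<close> free of cycles; enlarge it to a maximal such set. Its complement is feasible by
  \<open>feasible_if_fundamental\<close> and contained in \<open>B\<close>, so minimality of \<open>B\<close> makes them equal.
\<close>

lemma min_feasible_fundamental:
  assumes B: "min_feasible B" and b: "b \<in> B"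
  shows "\<exists>c. (c, {}) \<in> L \<and> c \<inter> B = {b}"
proof -
  define \<P> where "\<P> = {P. P \<subseteq> E \<and> (\<forall>p. (p, {}) \<in> L \<longrightarrow> p \<subseteq> P \<longrightarrow> p = {})}"
  have feasB: "feasible B" and BE: "B \<subseteq> E" using B by (auto simp: min_feasible_def feasible_def)
  have "E - B \<in> \<P>" using feasibleD[OF feasB, of _ "{}"] by (auto simp: \<P>_def)
  moreover have "finite \<P>" using finite_E by (auto simp: \<P>_def)
  ultimately obtain P where P: "P \<in> \<P>" "E - B \<subseteq> P" and max: "\<And>P'. P' \<in> \<P> \<Longrightarrow> P \<subseteq> P' \<Longrightarrow> P' = P"
    using finite_has_maximal2[of \<P> "E - B"] by metis
  have fund: "\<exists>c. (c, {}) \<in> L \<and> c \<inter> (E - P) = {x}" if x: "x \<in> E - P" for x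
  proof -
    have "insert x P \<notin> \<P>" using max[of "insert x P"] x by blast
    then obtain c where c: "(c, {}) \<in> L" "c \<subseteq> insert x P" "c \<noteq> {}"
      using P(1) x by (auto simp: \<P>_def)
    moreover have "x \<in> c" using c P(1) by (auto simp: \<P>_def)
    ultimately show ?thesis using x by blast
  qed
  have "feasible (E - P)"
  proof (rule feasible_if_fundamental[OF _ fund])
    fix p assume "(p, {}) \<in> L" "p \<inter> (E - P) = {}"
    then have "p \<subseteq> P" "(p, {}) \<in> L" using L_subset by auto
    then show "p = {}" using P(1) by (simp add: \<P>_def)
  qed auto
  then have "card B \<le> card (E - P)" using B by (simp add: min_feasible_def)
  moreover have "E - P \<subseteq> B" using P(2) by blast
  ultimately have "E - P = B" using BE finite_E by (metis card_seteq finite_subset)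
  then show ?thesis using fund b by blast
qed

text \<open>
  The vectors whose first coordinate lives outside \<open>F\<close> and whose second coordinate lives on \<open>F\<close> and \<open>e\<close>
  number \<open>2\<^bsup>|E| + 1\<^esup>\<close>, so two of them differ by a nonzero vector of \<open>L\<close>. Feasibility of \<open>F\<close> forces it to involve
  \<open>e\<close>.
\<close>

lemma feasible_cofundamental:
  assumes F: "feasible F" and e: "e \<in> E - F"
  shows "\<exists>p q. (p, q) \<in> L \<and> p \<inter> F = {} \<and> q \<subseteq> insert e F \<and> e \<in> q"
proof -
  have FE: "F \<subseteq> E" using F by (simp add: feasible_def)
  let ?S = "Pow (E - F) \<times> Pow (insert e F)"
  have fin: "finite F" using FE finite_E finite_subset by blast
  have "card ?S = 2 ^ (card E - card F) * 2 ^ Suc (card F)"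
    using fin finite_E FE e by (simp add: card_cartesian_product card_Pow card_Diff_subset)
  also have "\<dots> = 2 ^ Suc (card E)"
    using card_mono[OF finite_E FE] by (simp flip: power_add)
  finally have big: "card ?S > 2 ^ card E" by simp
  obtain x y where xy: "x \<in> ?S" "y \<in> ?S" "x \<noteq> y" "(fst x \<triangle> fst y, snd x \<triangle> snd y) \<in> L"
    by (rule two_vectors_differ_in_L[OF _ _ big, of fst snd]) (use finite_E fin FE e in auto)
  define p q where "p = fst x \<triangle> fst y" and "q = snd x \<triangle> snd y"
  have "p \<inter> F = {}" "q \<subseteq> insert e F"
    using xy(1,2) by (auto simp: p_def q_def)
  moreover have "\<not> (p = {} \<and> q = {})"
    using xy(3) by (auto simp: p_def q_def prod_eq_iff set_eq_iff)
  moreover have pq: "(p, q) \<in> L" using xy(4) by (simp add: p_def q_def)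
  ultimately have "e \<in> q" using feasibleD[OF F pq] by blast
  then show ?thesis using pq \<open>p \<inter> F = {}\<close> \<open>q \<subseteq> insert e F\<close> by blast
qed

text \<open>
  Basis exchange in \<open>D\<^sub>m\<^sub>i\<^sub>n\<close>. The fundamental cycle \<open>c\<close> of \<open>b\<close> meets \<open>q\<close> at most in \<open>b\<close> and \<open>e\<close>, so by
  orthogonality it contains \<open>e\<close>. A vector violating feasibility of the new set has no second
  coordinate at \<open>e\<close>, again by orthogonality to \<open>c\<close>, and becomes one violating feasibility of \<open>B\<close>,
  possibly after adding \<open>c\<close>.
\<close>

lemma min_feasible_exchange:
  assumes B: "min_feasible B" and e: "e \<in> E - B"
    and pq: "(p, q) \<in> L" "p \<inter> B = {}" "q \<subseteq> insert e B" "e \<in> q"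
    and b: "b \<in> q" "b \<noteq> e"
  shows "min_feasible (insert e (B - {b}))"
proof -
  let ?B = "insert e (B - {b})"
  have feasB: "feasible B" using B by (simp add: min_feasible_def)
  then have BE: "B \<subseteq> E" by (simp add: feasible_def)
  have bB: "b \<in> B" using pq(3) b by blast
  then obtain c where c: "(c, {}) \<in> L" "c \<inter> B = {b}"
    using min_feasible_fundamental[OF B] by blast
  have "e \<in> c"
  proof (rule ccontr)
    assume "e \<notin> c"
    then have "c \<inter> q = {b}" using b c(2) pq(3) by blast
    then show False using even_card_Int_L[OF c(1) pq(1)] by simp
  qed
  have "feasible ?B"
  proof (rule feasibleI)
    fix p' q' assume pq': "(p', q') \<in> L" and *: "p' \<inter> ?B = {}" "q' \<subseteq> ?B"
    have "e \<notin> q'"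
    proof
      assume "e \<in> q'"
      then have "c \<inter> q' = {e}" using \<open>e \<in> c\<close> c(2) *(2) by blast
      then show False using even_card_Int_L[OF c(1) pq'] by simp
    qed
    then have q': "q' \<subseteq> B" using *(2) by blast
    have "b \<notin> p'"
    proof
      assume "b \<in> p'"
      then have "p' \<inter> B = {b}" using *(1) bB by blast
      then have "(p' \<triangle> c) \<inter> B = {}" using c(2) unfolding sym_diff_set_def by blast
      moreover have "(p' \<triangle> c, q') \<in> L"
        using L_add[OF pq' c(1)] by (simp add: sym_diff_set_def)
      ultimately have "p' \<triangle> c = {}" using feasibleD[OF feasB] q' by blast
      then show False using \<open>e \<in> c\<close> *(1) by (auto simp: set_eq_iff)
    qed
    then have "p' \<inter> B = {}" using *(1) by blast
    then show "p' = {} \<and> q' = {}" using feasibleD[OF feasB pq' _ q'] by blast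
  qed (use BE e in blast)
  moreover have "card ?B = card B"
    using bB e BE finite_E by (metis DiffD1 DiffD2 card_Suc_Diff1 card_insert_disjoint finite_Diff finite_subset)
  ultimately show ?thesis using B by (simp add: min_feasible_def)
qed

text \<open>
  The second coordinates of \<open>L\<close> are the dependencies of \<open>D\<^sub>m\<^sub>i\<^sub>n\<close>. One direction is orthogonality to
  fundamental cycles. For the other, take a minimum feasible set missing as little of \<open>I\<close> as
  possible; while it misses some \<open>e \<in> I\<close>, the vector through \<open>e\<close> reaches outside \<open>I\<close> and offers an
  exchange that gains \<open>e\<close> without losing an element of \<open>I\<close>.
\<close>

lemma subset_min_feasible_iff:
  assumes IE: "I \<subseteq> E" and ex: "\<exists>B. min_feasible B"
  shows "(\<exists>B. min_feasible B \<and> I \<subseteq> B) \<longleftrightarrow> (\<forall>(p, q)\<in>L. q \<subseteq> I \<longrightarrow> q = {})"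
proof
  assume "\<exists>B. min_feasible B \<and> I \<subseteq> B"
  then obtain B where B: "min_feasible B" "I \<subseteq> B" by blast
  show "\<forall>(p, q)\<in>L. q \<subseteq> I \<longrightarrow> q = {}"
  proof (clarify, rule ccontr)
    fix p q assume pq: "(p, q) \<in> L" "q \<subseteq> I" "q \<noteq> {}"
    then obtain b where b: "b \<in> q" by blast
    then obtain c where c: "(c, {}) \<in> L" "c \<inter> B = {b}"
      using min_feasible_fundamental[OF B(1)] pq(2) B(2) by blast
    have "c \<inter> q = {b}" using b c(2) pq(2) B(2) by blast
    then show False using even_card_Int_L[OF c(1) pq(1)] by simp
  qed
next
  assume free: "\<forall>(p, q)\<in>L. q \<subseteq> I \<longrightarrow> q = {}"
  have finI: "finite I" using IE finite_E finite_subset by blast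
  show "\<exists>B. min_feasible B \<and> I \<subseteq> B"
  proof -
    obtain B where B: "min_feasible B" and least: "\<And>B'. min_feasible B' \<Longrightarrow> card (I - B) \<le> card (I - B')"
      using ex_has_least_nat[of min_feasible _ "\<lambda>B. card (I - B)"] ex by blast
    have "I \<subseteq> B"
    proof (rule ccontr)
      assume "\<not> I \<subseteq> B"
      then obtain e where e: "e \<in> I" "e \<notin> B" by blast
      then have eE: "e \<in> E - B" using IE by blast
      obtain p q where pq: "(p, q) \<in> L" "p \<inter> B = {}" "q \<subseteq> insert e B" "e \<in> q"
        using feasible_cofundamental[OF _ eE] B by (auto simp: min_feasible_def)
      then obtain b where b: "b \<in> q" "b \<notin> I" using free by blast
      then have "min_feasible (insert e (B - {b}))"
        using min_feasible_exchange[OF B eE pq b(1)] e(1) by blast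
      then have "card (I - B) \<le> card (I - insert e (B - {b}))" by (rule least)
      moreover have "I - insert e (B - {b}) \<subset> I - B" using e b(2) by blast
      then have "card (I - insert e (B - {b})) < card (I - B)"
        using finI by (intro psubset_card_mono) auto
      ultimately show False by linarith
    qed
    then show ?thesis using B by blast
  qed
qed

text \<open>
  The circuits of \<open>D\<^sub>m\<^sub>i\<^sub>n\<close> are the minimal nonempty second coordinates, and evenness passes from minimal
  ones to all.
\<close>

lemma bipartite_iff_even_second:
  assumes D: "ground D = E" "members D = Collect feasible" and ne: "members D \<noteq> {}"
  shows "bipartite D \<longleftrightarrow> (\<forall>(p, q)\<in>L. even (card q))"
proof -
  have ex: "\<exists>B. min_feasible B"
    using ne ex_has_least_nat[of feasible _ card] by (auto simp: D min_feasible_def)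
  define N where "N = snd ` L"
  have N_E: "N \<subseteq> Pow E" using L_subset unfolding N_def by fastforce
  have indep: "I \<in> members (D_min D) \<longleftrightarrow> (\<forall>q\<in>N. q \<subseteq> I \<longrightarrow> q = {})" if "I \<in> Pow E" for I
  proof -
    have "I \<in> members (D_min D) \<longleftrightarrow> (\<exists>B. min_feasible B \<and> I \<subseteq> B)"
      by (auto simp: D_min_def min_members_def D min_feasible_def)
    also have "\<dots> \<longleftrightarrow> (\<forall>(p, q)\<in>L. q \<subseteq> I \<longrightarrow> q = {})"
      using that by (intro subset_min_feasible_iff ex) simp
    finally show ?thesis by (simp add: N_def case_prod_beta)
  qed
  have "matroid_circuits (D_min D) =
      {C \<in> Pow E. C \<notin> members (D_min D) \<and> (\<forall>C'\<in>Pow E. C' \<subset> C \<longrightarrow> C' \<in> members (D_min D))}"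
  proof -
    have ground: "ground (D_min D) = E" by (simp add: D_min_def D)
    have "C' \<in> Pow E" if "C' \<subset> C" "C \<subseteq> E" for C' C using that by blast
    then show ?thesis unfolding matroid_circuits_def ground by (intro Collect_cong) (metis PowD PowI)
  qed
  also have "\<dots> = {q \<in> N. q \<noteq> {} \<and> (\<forall>B\<in>N. B \<subset> q \<longrightarrow> B = {})}"
    using N_E indep by (intro minimal_dependent_eq_minimal_members) auto
  finally have circ: "matroid_circuits (D_min D) = \<dots>" .
  have fin: "finite q" if "q \<in> N" for q
    using that N_E finite_E finite_subset[of q E] by blast
  have diff: "q - q' \<in> N" if q: "q \<in> N" "q' \<in> N" "q' \<subset> q" for q q'
  proof -
    obtain p p' where "(p, q) \<in> L" "(p', q') \<in> L" using q(1,2) by (auto simp: N_def)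
    then have "q \<triangle> q' \<in> N" using L_add unfolding N_def by force
    moreover have "q \<triangle> q' = q - q'" using q(3) by (auto simp: sym_diff_set_def)
    ultimately show ?thesis by simp
  qed
  have "bipartite D \<longleftrightarrow>
      (\<forall>q\<in>N. q \<noteq> {} \<and> (\<forall>B\<in>N. B \<subset> q \<longrightarrow> B = {}) \<longrightarrow> even (card (q \<inter> UNIV)))"
    unfolding bipartite_def circ by simp blast
  also have "\<dots> \<longleftrightarrow> (\<forall>q\<in>N. even (card (q \<inter> UNIV)))"
    using fin diff by (rule minimal_members_even_iff)
  also have "\<dots> \<longleftrightarrow> (\<forall>(p, q)\<in>L. even (card q))"
    by (simp add: N_def case_prod_beta)
  finally show ?thesis .
qed

end

section \<open>Binary delta-matroids come from Lagrangian subspaces\<close>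

lemma mat_image_sym_diff:
  assumes "finite q" "finite q'"
  shows "mat_image E A (q \<triangle> q') = mat_image E A q \<triangle> mat_image E A q'"
  using assms by (auto simp: mat_image_def sum_sym_diff_bit bit_add_eq_0_iff)

text \<open>
  Both intersections count, modulo 2, the ones of \<open>A\<close> in the block \<open>q \<times> q'\<close>.
\<close>

lemma even_card_mat_image_symmetric:
  assumes fin: "finite E" and sym: "\<And>i j. i \<in> E \<Longrightarrow> j \<in> E \<Longrightarrow> A i j = A j i"
    and q: "q \<subseteq> E" "q' \<subseteq> E"
  shows "even (card ((mat_image E A q \<inter> q') \<triangle> (q \<inter> mat_image E A q')))"
proof -
  have pair: "(\<Sum>i\<in>mat_image E A s \<inter> r. 1) = (\<Sum>i\<in>r. \<Sum>j\<in>s. A i j)" if "r \<subseteq> E" for r s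
  proof -
    have "(\<Sum>i\<in>r. \<Sum>j\<in>s. A i j) = (\<Sum>i\<in>r. if i \<in> mat_image E A s then 1 else 0)"
      using that by (intro sum.cong) (auto simp: mat_image_def)
    also have "\<dots> = (\<Sum>i\<in>r \<inter> mat_image E A s. 1)"
      using that fin by (intro sum.inter_restrict[symmetric]) (rule finite_subset)
    finally show ?thesis by (simp add: Int_commute)
  qed
  (* Symmetry of A enters here. *)
  have "(\<Sum>i\<in>q'. \<Sum>j\<in>q. A i j) = (\<Sum>j\<in>q. \<Sum>i\<in>q'. A j i)"
    by (subst sum.swap) (use sym q in \<open>auto intro!: sum.cong\<close>)
  then have "(\<Sum>i\<in>mat_image E A q \<inter> q'. 1 :: bit) = (\<Sum>i\<in>q \<inter> mat_image E A q'. 1)"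
    using pair[OF q(1), of q'] pair[OF q(2), of q] by (simp only: Int_commute)
  moreover have "finite (mat_image E A q \<inter> q')" "finite (q \<inter> mat_image E A q')"
    using fin q by (auto intro: finite_subset)
  ultimately show ?thesis
    unfolding even_card_iff by (simp only: sum_sym_diff_bit bit_add_self)
qed

text \<open>
  The first coordinate of the vector that arises from \<open>(p, q)\<close> by exchanging its coordinates on \<open>X\<close>; the
  second coordinate is \<open>exchange_on X q p\<close>.
\<close>

definition exchange_on :: "'a set \<Rightarrow> 'a set \<Rightarrow> 'a set \<Rightarrow> 'a set" where
  "exchange_on X p q = (p - X) \<union> (q \<inter> X)"

definition twisted_graph :: "'a set \<Rightarrow> ('a \<Rightarrow> 'a \<Rightarrow> bit) \<Rightarrow> 'a set \<Rightarrow> ('a set \<times> 'a set) set" where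
  "twisted_graph E A X =
    {(p, q). p \<subseteq> E \<and> q \<subseteq> E \<and> exchange_on X p q = mat_image E A (exchange_on X q p)}"

lemma exchange_on_exchange_on: "exchange_on X (exchange_on X p q) (exchange_on X q p) = p"
  by (auto simp: exchange_on_def)

lemma exchange_on_subset: "p \<subseteq> E \<Longrightarrow> q \<subseteq> E \<Longrightarrow> exchange_on X p q \<subseteq> E"
  by (auto simp: exchange_on_def)

lemma exchange_on_sym_diff:
  "exchange_on X (p \<triangle> p') (q \<triangle> q') = exchange_on X p q \<triangle> exchange_on X p' q'"
  by (auto simp: exchange_on_def)

lemma exchange_on_symplectic:
  "(exchange_on X p q \<inter> exchange_on X q' p') \<triangle> (exchange_on X q p \<inter> exchange_on X p' q') =
    (p \<inter> q') \<triangle> (q \<inter> p')"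
  unfolding exchange_on_def sym_diff_set_def by blast

lemma mat_image_subset: "mat_image E A q \<subseteq> E"
  by (auto simp: mat_image_def)

text \<open>
  The graph of \<open>A\<close> has one vector for each \<open>q\<close>, and it is isotropic because \<open>A\<close> is symmetric. Exchanging
  the two coordinates in some places preserves sums and the symplectic form.
\<close>

lemma lagrangian_twisted_graph:
  assumes fin: "finite E" and sym: "\<And>i j. i \<in> E \<Longrightarrow> j \<in> E \<Longrightarrow> A i j = A j i"
  shows "lagrangian E (twisted_graph E A X)"
proof
  show "twisted_graph E A X \<subseteq> Pow E \<times> Pow E" by (auto simp: twisted_graph_def)
  show "({}, {}) \<in> twisted_graph E A X"
    by (simp add: twisted_graph_def exchange_on_def mat_image_def)
next
  fix p q p' q' assume pq: "(p, q) \<in> twisted_graph E A X" "(p', q') \<in> twisted_graph E A X"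
  then have "p \<subseteq> E" "q \<subseteq> E" "p' \<subseteq> E" "q' \<subseteq> E" by (simp_all add: twisted_graph_def)
  then have fin': "finite (exchange_on X q p)" "finite (exchange_on X q' p')"
    by (auto intro: finite_subset[OF exchange_on_subset fin])
  show "(p \<triangle> p', q \<triangle> q') \<in> twisted_graph E A X"
    using pq by (auto simp only: twisted_graph_def mem_Collect_eq prod.case exchange_on_sym_diff
        mat_image_sym_diff[OF fin'] sym_diff_subset)
  have "even (card ((exchange_on X p q \<inter> exchange_on X q' p') \<triangle>
      (exchange_on X q p \<inter> exchange_on X p' q')))"
    using pq even_card_mat_image_symmetric[OF fin sym,
        where q = "exchange_on X q p" and q' = "exchange_on X q' p'"]
    by (simp add: twisted_graph_def exchange_on_subset)
  then show "even (card ((p \<inter> q') \<triangle> (q \<inter> p')))"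
    by (simp only: exchange_on_symplectic)
next
  let ?g = "\<lambda>r. (exchange_on X (mat_image E A r) r, exchange_on X r (mat_image E A r))"
  have "bij_betw ?g (Pow E) (twisted_graph E A X)"
  proof (rule bij_betw_byWitness[where f' = "\<lambda>(p, q). exchange_on X q p"])
    show "\<forall>r\<in>Pow E. (case ?g r of (p, q) \<Rightarrow> exchange_on X q p) = r"
      by (simp add: exchange_on_exchange_on)
    show "\<forall>pq\<in>twisted_graph E A X. ?g (case pq of (p, q) \<Rightarrow> exchange_on X q p) = pq"
    proof
      fix pq assume *: "pq \<in> twisted_graph E A X"
      obtain p q where pq: "pq = (p, q)" by (cases pq)
      with *  have "mat_image E A (exchange_on X q p) = exchange_on X p q"
        by (simp add: twisted_graph_def)
      then show "?g (case pq of (p, q) \<Rightarrow> exchange_on X q p) = pq"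
        by (simp add: pq exchange_on_exchange_on)
    qed
    show "?g ` Pow E \<subseteq> twisted_graph E A X"
    proof (rule image_subsetI)
      fix r assume "r \<in> Pow E"
      then show "?g r \<in> twisted_graph E A X"
        by (simp add: twisted_graph_def exchange_on_exchange_on exchange_on_subset mat_image_subset)
    qed
    show "(\<lambda>(p, q). exchange_on X q p) ` twisted_graph E A X \<subseteq> Pow E"
      by (rule image_subsetI) (auto simp: twisted_graph_def exchange_on_def)
  qed
  then show "card (twisted_graph E A X) = 2 ^ card E"
    using bij_betw_same_card[of ?g "Pow E" "twisted_graph E A X"] fin by (simp add: card_Pow)
qed (fact fin)

text \<open>
  A vector of the graph of \<open>A\<close> that violates feasibility of \<open>G\<close> is exactly a nonzero kernel vector of
  the principal submatrix on \<open>G\<close>. Exchanging coordinates on \<open>X\<close> turns \<open>F\<close> into \<open>F \<triangle> X\<close>.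
\<close>

lemma feasible_twisted_graph_iff:
  assumes fin: "finite E" and sym: "\<And>i j. i \<in> E \<Longrightarrow> j \<in> E \<Longrightarrow> A i j = A j i"
    and X: "X \<subseteq> E" and F: "F \<subseteq> E"
  shows "lagrangian.feasible E (twisted_graph E A X) F \<longleftrightarrow> det_on (F \<triangle> X) A \<noteq> 0"
proof -
  interpret lagrangian E "twisted_graph E A X" using fin sym by (rule lagrangian_twisted_graph)
  let ?G = "F \<triangle> X"
  have G: "?G \<subseteq> E" using F X by (rule sym_diff_subset)
  have fin_G: "finite ?G" using G fin by (rule finite_subset)
  have mi: "mat_image ?G A r = mat_image E A r \<inter> ?G" for r
    using G by (auto simp: mat_image_def)
  have coord: "p \<inter> F = {} \<and> q \<subseteq> F \<longleftrightarrow> exchange_on X p q \<inter> ?G = {} \<and> exchange_on X q p \<subseteq> ?G"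
    for p q unfolding exchange_on_def sym_diff_set_def by blast
  show ?thesis
    unfolding det_on_eq_0_iff[OF fin_G] mi
  proof
    assume feas: "feasible F"
    show "\<not> (\<exists>r\<subseteq>?G. r \<noteq> {} \<and> mat_image E A r \<inter> ?G = {})"
    proof
      assume "\<exists>r\<subseteq>?G. r \<noteq> {} \<and> mat_image E A r \<inter> ?G = {}"
      then obtain r where r: "r \<subseteq> ?G" "r \<noteq> {}" "mat_image E A r \<inter> ?G = {}" by blast
      define p q where "p = exchange_on X (mat_image E A r) r"
        and "q = exchange_on X r (mat_image E A r)"
      then have pq: "exchange_on X p q = mat_image E A r" "exchange_on X q p = r"
        by (simp_all add: exchange_on_exchange_on)
      have "p \<subseteq> E" "q \<subseteq> E"
        unfolding p_def q_def using r(1) G by (intro exchange_on_subset mat_image_subset; blast)+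
      then have "(p, q) \<in> twisted_graph E A X" by (simp add: twisted_graph_def pq)
      then have "p = {} \<and> q = {}"
        using feasibleD[OF feas] coord[of p q] r by (simp add: pq)
      then show False using pq(2) r(2) by (simp add: exchange_on_def)
    qed
  next
    assume nonsing: "\<not> (\<exists>r\<subseteq>?G. r \<noteq> {} \<and> mat_image E A r \<inter> ?G = {})"
    show "feasible F"
    proof (rule feasibleI[OF F])
      fix p q assume pq: "(p, q) \<in> twisted_graph E A X" "p \<inter> F = {}" "q \<subseteq> F"
      then have eq: "exchange_on X p q = mat_image E A (exchange_on X q p)"
        by (simp add: twisted_graph_def)
      have "exchange_on X q p = {}" using coord[of p q] pq(2,3) nonsing eq by auto
      moreover from this have "exchange_on X p q = {}" using eq by (simp add: mat_image_def)
      ultimately show "p = {} \<and> q = {}" by (auto simp: exchange_on_def)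
    qed
  qed
qed

lemma binary_lagrangian:
  assumes D: "delta_matroid D" and bin: "is_binary D"
  obtains L where "lagrangian (ground D) L" "members D = Collect (lagrangian.feasible (ground D) L)"
proof -
  let ?E = "ground D"
  have fin: "finite ?E" and sub: "members D \<subseteq> Pow ?E"
    using D by (auto simp: delta_matroid_def set_system_def)
  obtain X and E' :: "'a set" and A where X: "X \<subseteq> ?E"
    and sym: "\<forall>i\<in>E'. \<forall>j\<in>E'. A i j = A j i"
    and iso: "isomorphic (twist D X) (matrix_system E' A)"
    using bin unfolding is_binary_def by blast
  obtain f where f: "bij_betw f ?E E'"
    and mem: "{Y. Y \<subseteq> E' \<and> det_on Y A \<noteq> 0} = (\<lambda>F. f ` F) ` (\<lambda>F. F \<triangle> X) ` members D"
    using iso by (auto simp: isomorphic_def twist_def matrix_system_def)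
  have inj: "inj_on f ?E" and im: "f ` ?E = E'" using f by (auto simp: bij_betw_def)
  define A' where "A' = (\<lambda>i j. A (f i) (f j))"
  have sym': "A' i j = A' j i" if "i \<in> ?E" "j \<in> ?E" for i j
    unfolding A'_def using sym bij_betwE[OF f] that by blast
  let ?L = "twisted_graph ?E A' X"
  have "F \<in> members D \<longleftrightarrow> det_on (F \<triangle> X) A' \<noteq> 0" if F: "F \<subseteq> ?E" for F
  proof -
    have G: "F \<triangle> X \<subseteq> ?E" using F X by (rule sym_diff_subset)
    have "det_on (f ` (F \<triangle> X)) A = det_on (F \<triangle> X) A'"
      unfolding A'_def using inj_on_subset[OF inj G] by (intro det_on_reindex) (simp add: bij_betw_def)
    moreover have "f ` (F \<triangle> X) \<subseteq> E'" using image_mono[OF G, of f] by (simp only: im)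
    ultimately have "det_on (F \<triangle> X) A' \<noteq> 0 \<longleftrightarrow> f ` (F \<triangle> X) \<in> {Y. Y \<subseteq> E' \<and> det_on Y A \<noteq> 0}"
      by simp
    also have "\<dots> \<longleftrightarrow> (\<exists>F'\<in>members D. f ` (F \<triangle> X) = f ` (F' \<triangle> X))"
      unfolding mem by blast
    also have "\<dots> \<longleftrightarrow> (\<exists>F'\<in>members D. F \<triangle> X = F' \<triangle> X)"
    proof -
      have "f ` (F \<triangle> X) = f ` (F' \<triangle> X) \<longleftrightarrow> F \<triangle> X = F' \<triangle> X" if "F' \<in> members D" for F'
        using that sub X by (intro inj_on_image_eq_iff[OF inj G] sym_diff_subset) auto
      then show ?thesis by (rule bex_cong[OF refl])
    qed
    also have "\<dots> \<longleftrightarrow> F \<in> members D"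
    proof -
      have "F \<triangle> X = F' \<triangle> X \<longleftrightarrow> F = F'" for F' by (metis sym_diff_cancel)
      then show ?thesis by simp
    qed
    finally show ?thesis ..
  qed
  then have eq: "F \<in> members D \<longleftrightarrow> lagrangian.feasible ?E ?L F" if "F \<subseteq> ?E" for F
    using feasible_twisted_graph_iff[OF fin sym' X that] that by simp
  interpret lagrangian ?E ?L using fin sym' by (rule lagrangian_twisted_graph)
  have "F \<in> members D \<longleftrightarrow> feasible F" for F
  proof (cases "F \<subseteq> ?E")
    case False
    then show ?thesis using sub by (auto simp: feasible_def)
  qed (rule eq)
  then have "members D = Collect feasible" by (simp add: set_eq_iff)
  with lagrangian_axioms show thesis by (rule that)
qed

section \<open>Carriers with labelled skew classes of size three\<close>

locale labelled_carrier =
  fixes E :: "'a set" and t :: "nat \<Rightarrow> 'a \<Rightarrow> 'b"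
  assumes finite_ground: "finite E" and labelling: "labelling E t"
begin

abbreviation U :: "'b set" where "U \<equiv> \<Union>e\<in>E. skew_class t e"
abbreviation \<Omega> :: "'b set set" where "\<Omega> \<equiv> skew_class t ` E"

lemma t_eq_iff:
  assumes "e \<in> E" "f \<in> E" "i \<in> {1, 2, 3}" "j \<in> {1, 2, 3}"
  shows "t i e = t j f \<longleftrightarrow> i = j \<and> e = f"
  using labelling assms unfolding labelling_def inj_on_def by fastforce

lemma t_simps [simp]:
  assumes "e \<in> E" "f \<in> E"
  shows "t 1 e = t 1 f \<longleftrightarrow> e = f" "t 2 e = t 2 f \<longleftrightarrow> e = f" "t 3 e = t 3 f \<longleftrightarrow> e = f"
    "t 1 e \<noteq> t 2 f" "t 1 e \<noteq> t 3 f" "t 2 e \<noteq> t 1 f" "t 2 e \<noteq> t 3 f" "t 3 e \<noteq> t 1 f" "t 3 e \<noteq> t 2 f"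
  using assms by (simp_all add: t_eq_iff)

lemma skew_class_disjoint:
  assumes "e \<in> E" "f \<in> E" "x \<in> skew_class t e" "x \<in> skew_class t f"
  shows "e = f"
  using assms by (auto simp: skew_class_def)

lemma finite_U: "finite U"
  using finite_ground by (simp add: skew_class_def)

lemma finite_skew_class: "finite (skew_class t e)"
  by (simp add: skew_class_def)

lemma card_skew_class: "e \<in> E \<Longrightarrow> card (skew_class t e) = 3"
  by (simp add: skew_class_def)

lemma partition_on_skew_classes: "partition_on U \<Omega>"
proof (rule partition_onI)
  fix p q assume "p \<in> \<Omega>" "q \<in> \<Omega>" "p \<noteq> q"
  then show "disjnt p q" using skew_class_disjoint by (fastforce simp: disjnt_def)
qed (auto simp: skew_class_def)

lemma subtransversal_iff:
  "subtransversal U \<Omega> S \<longleftrightarrow> S \<subseteq> U \<and>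
    (\<forall>e\<in>E. \<forall>x\<in>skew_class t e. \<forall>y\<in>skew_class t e. x \<in> S \<longrightarrow> y \<in> S \<longrightarrow> x = y)"
proof -
  have "card (S \<inter> skew_class t e) \<le> 1 \<longleftrightarrow>
      (\<forall>x\<in>skew_class t e. \<forall>y\<in>skew_class t e. x \<in> S \<longrightarrow> y \<in> S \<longrightarrow> x = y)" for e
    using card_le_Suc0_iff_eq[of "S \<inter> skew_class t e"] finite_skew_class[of e]
    by (auto simp: One_nat_def)
  then show ?thesis by (simp add: subtransversal_def)
qed

lemma subtransversalD:
  assumes "subtransversal U \<Omega> S" "e \<in> E" "x \<in> skew_class t e" "y \<in> skew_class t e" "x \<in> S" "y \<in> S"
  shows "x = y"
  using assms unfolding subtransversal_iff by blast

lemma transversal_iff: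
  "transversal U \<Omega> T \<longleftrightarrow> subtransversal U \<Omega> T \<and> (\<forall>e\<in>E. \<exists>x\<in>skew_class t e. x \<in> T)"
proof -
  have "card (T \<inter> skew_class t e) = 1 \<longleftrightarrow>
      card (T \<inter> skew_class t e) \<le> 1 \<and> (\<exists>x\<in>skew_class t e. x \<in> T)" for e
  proof -
    have "0 < card (T \<inter> skew_class t e) \<longleftrightarrow> (\<exists>x\<in>skew_class t e. x \<in> T)"
      using finite_skew_class[of e] by (auto simp: card_gt_0_iff)
    then show ?thesis by linarith
  qed
  then show ?thesis unfolding transversal_def subtransversal_def by auto
qed

lemma transversalD:
  assumes "transversal U \<Omega> T"
  shows "subtransversal U \<Omega> T" "e \<in> E \<Longrightarrow> \<exists>x\<in>skew_class t e. x \<in> T"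
  using assms by (simp_all only: transversal_iff)

lemma subtransversal_subset:
  "subtransversal U \<Omega> S \<Longrightarrow> S' \<subseteq> S \<Longrightarrow> subtransversal U \<Omega> S'"
  unfolding subtransversal_iff by blast

lemma finite_subtransversal: "subtransversal U \<Omega> S \<Longrightarrow> finite S"
  using finite_subset[OF _ finite_U] unfolding subtransversal_def by blast

lemma transversal_maximal:
  assumes T: "transversal U \<Omega> T" and S: "subtransversal U \<Omega> S" and "T \<subseteq> S"
  shows "S = T"
proof -
  have "x \<in> T" if x: "x \<in> S" for x
  proof -
    obtain e where e: "e \<in> E" "x \<in> skew_class t e"
      using x S unfolding subtransversal_def by blast
    obtain y where y: "y \<in> skew_class t e" "y \<in> T" using transversalD(2)[OF T e(1)] by blast
    then have "x = y" using subtransversalD[OF S e(1) e(2) y(1) x] assms(3) by blast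
    then show ?thesis using y(2) by simp
  qed
  then show ?thesis using assms(3) by blast
qed

lemma subtransversal_insert:
  assumes I: "subtransversal U \<Omega> I" and e: "e \<in> E" "skew_class t e \<inter> I = {}" "x \<in> skew_class t e"
  shows "subtransversal U \<Omega> (insert x I)"
  unfolding subtransversal_iff
proof (intro conjI ballI impI)
  show "insert x I \<subseteq> U" using I e(1,3) unfolding subtransversal_def by blast
next
  fix f y z
  assume f: "f \<in> E" "y \<in> skew_class t f" "z \<in> skew_class t f" "y \<in> insert x I" "z \<in> insert x I"
  show "y = z"
  proof (cases "f = e")
    case True
    then show ?thesis using f e(2) by blast
  next
    case False
    then have "x \<notin> skew_class t f" using skew_class_disjoint[OF f(1) e(1) _ e(3)] by blast
    then show ?thesis using subtransversalD[OF I f(1-3)] f by blast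
  qed
qed

lemma transversal_exchange:
  assumes T: "transversal U \<Omega> T" and e: "e \<in> E" and u: "u \<in> skew_class t e"
  shows "transversal U \<Omega> (insert u (T - skew_class t e))"
  unfolding transversal_iff
proof (intro conjI ballI)
  have "subtransversal U \<Omega> (T - skew_class t e)"
    by (rule subtransversal_subset[OF transversalD(1)[OF T]]) blast
  then show "subtransversal U \<Omega> (insert u (T - skew_class t e))"
    using e u by (intro subtransversal_insert[of _ e]) auto
next
  fix f assume f: "f \<in> E"
  show "\<exists>x\<in>skew_class t f. x \<in> insert u (T - skew_class t e)"
  proof (cases "f = e")
    case True
    then show ?thesis using u by blast
  next
    case False
    obtain x where x: "x \<in> skew_class t f" "x \<in> T" using transversalD(2)[OF T f] by blast
    then have "x \<notin> skew_class t e" using skew_class_disjoint[OF f e] False by blast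
    then show ?thesis using x by blast
  qed
qed

lemma two_label_transversal:
  assumes "X \<subseteq> E"
  shows "transversal U \<Omega> (t 1 ` (E - X) \<union> t 2 ` X)"
  unfolding transversal_iff subtransversal_iff
proof (intro conjI ballI impI)
  show "t 1 ` (E - X) \<union> t 2 ` X \<subseteq> U" using assms by (auto simp: skew_class_def)
next
  fix e x y
  assume "e \<in> E" "x \<in> skew_class t e" "y \<in> skew_class t e"
    "x \<in> t 1 ` (E - X) \<union> t 2 ` X" "y \<in> t 1 ` (E - X) \<union> t 2 ` X"
  moreover have "f \<in> E" if "f \<in> X" for f using that assms by blast
  ultimately show "x = y" by (auto simp: skew_class_def)
next
  fix e assume "e \<in> E"
  then show "\<exists>x\<in>skew_class t e. x \<in> t 1 ` (E - X) \<union> t 2 ` X"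
    by (cases "e \<in> X") (auto simp: skew_class_def)
qed

lemma transversal_avoiding_third:
  assumes T: "transversal U \<Omega> T" and third: "T \<inter> T_set E t 3 = {}"
  shows "T = t 1 ` (E - {e \<in> E. t 2 e \<in> T}) \<union> t 2 ` {e \<in> E. t 2 e \<in> T}" (is "T = ?S")
proof -
  have "t 1 e \<in> T" if e: "e \<in> E" "t 2 e \<notin> T" for e
  proof -
    obtain x where "x \<in> skew_class t e" "x \<in> T" using transversalD(2)[OF T e(1)] by blast
    moreover have "t 3 e \<notin> T" using third e(1) unfolding T_set_def by blast
    ultimately show ?thesis using e(2) unfolding skew_class_def by blast
  qed
  then have "?S \<subseteq> T" by auto
  moreover have "transversal U \<Omega> ?S" by (rule two_label_transversal) simp
  ultimately show ?thesis using transversal_maximal[OF _ transversalD(1)[OF T]] by blast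
qed

end

locale three_matroid_on_carrier = labelled_carrier E t
  for E :: "'a set" and t :: "nat \<Rightarrow> 'a \<Rightarrow> 'b" +
  fixes Z :: "'b multimatroid"
  assumes three_matroid: "three_matroid Z"
    and carrier_Z: "multimatroid.carrier Z = U" and classes_Z: "skew_classes Z = \<Omega>"
begin

lemma indep_subtransversal: "I \<in> indep Z \<Longrightarrow> subtransversal U \<Omega> I"
  using three_matroid unfolding three_matroid_def multimatroid_def carrier_Z classes_Z by blast

lemma indep_insert:
  assumes "I \<in> indep Z" "e \<in> E" "skew_class t e \<inter> I = {}"
    "x \<in> skew_class t e" "y \<in> skew_class t e" "x \<noteq> y"
  shows "insert x I \<in> indep Z \<or> insert y I \<in> indep Z"
  using three_matroid assms unfolding three_matroid_def multimatroid_def carrier_Z classes_Z by blast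

lemma indep_subset:
  assumes T: "transversal U \<Omega> T" "T \<in> indep Z" and I: "I \<subseteq> T"
  shows "I \<in> indep Z"
proof -
  have "matroid \<lparr>ground = T, members = indep Z \<inter> Pow T\<rparr>"
    using three_matroid T(1) unfolding three_matroid_def multimatroid_def carrier_Z classes_Z by blast
  then have "\<forall>J\<in>indep Z \<inter> Pow T. \<forall>I\<subseteq>J. I \<in> indep Z \<inter> Pow T"
    unfolding matroid_def set_system.simps by (elim conjE)
  then show ?thesis using T(2) I by blast
qed

lemma indep_extends:
  assumes I: "I \<in> indep Z"
  shows "\<exists>T\<in>indep Z. transversal U \<Omega> T \<and> I \<subseteq> T"
proof -
  have "indep Z \<subseteq> Pow U" using indep_subtransversal by (auto simp: subtransversal_def)
  then have "finite (indep Z)" using finite_U by (meson finite_Pow_iff finite_subset)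
  then obtain T where T: "T \<in> indep Z" "I \<subseteq> T" and max: "\<And>J. J \<in> indep Z \<Longrightarrow> T \<subseteq> J \<Longrightarrow> T = J"
    using finite_has_maximal2[OF _ I] by metis
  have "\<exists>x\<in>skew_class t e. x \<in> T" if e: "e \<in> E" for e
  proof (rule ccontr)
    assume *: "\<not> (\<exists>x\<in>skew_class t e. x \<in> T)"
    then have disj: "skew_class t e \<inter> T = {}" by blast
    have x: "t 1 e \<in> skew_class t e" "t 2 e \<in> skew_class t e" by (simp_all add: skew_class_def)
    have "insert (t 1 e) T \<in> indep Z \<or> insert (t 2 e) T \<in> indep Z"
      by (rule indep_insert[OF T(1) e disj x]) (simp add: e)
    then show False using max x disj by blast
  qed
  then show ?thesis using T indep_subtransversal by (auto simp: transversal_iff)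
qed

lemma indep_iff: "I \<in> indep Z \<longleftrightarrow> (\<exists>T. transversal U \<Omega> T \<and> T \<in> indep Z \<and> I \<subseteq> T)"
  using indep_extends indep_subset by blast

lemma bases_iff: "B \<in> bases Z \<longleftrightarrow> B \<in> indep Z \<and> transversal U \<Omega> B"
proof
  assume B: "B \<in> bases Z"
  then have "B \<in> indep Z" by (simp add: bases_def)
  moreover from indep_extends[OF this] obtain T where "T \<in> indep Z" "transversal U \<Omega> T" "B \<subseteq> T" by blast
  moreover from this have "T = B" using B by (simp add: bases_def)
  ultimately show "B \<in> indep Z \<and> transversal U \<Omega> B" by simp
next
  assume "B \<in> indep Z \<and> transversal U \<Omega> B"
  then show "B \<in> bases Z"
    using transversal_maximal indep_subtransversal unfolding bases_def by blast
qed

lemma members_D_of_iff: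
  "X \<in> members (D_of E t Z) \<longleftrightarrow> X \<subseteq> E \<and> t 1 ` (E - X) \<union> t 2 ` X \<in> indep Z"
proof -
  have "t 1 ` (E - X) \<union> t 2 ` X \<in> bases (delete Z (T_set E t 3)) \<longleftrightarrow>
      t 1 ` (E - X) \<union> t 2 ` X \<in> indep Z" (is "?S \<in> _ \<longleftrightarrow> _") if X: "X \<subseteq> E"
  proof
    assume "?S \<in> bases (delete Z (T_set E t 3))"
    then show "?S \<in> indep Z" by (simp add: bases_def delete_def)
  next
    assume S: "?S \<in> indep Z"
    have "e \<in> E" if "e \<in> X" for e using that X by blast
    then have "?S \<inter> T_set E t 3 = {}" by (auto simp: T_set_def)
    moreover have "?S \<subseteq> U" using two_label_transversal[OF X] by (simp add: transversal_def)
    ultimately have avoid: "?S \<subseteq> multimatroid.carrier Z - T_set E t 3" unfolding carrier_Z by blast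
    have max: "J = ?S" if "J \<in> indep Z" "?S \<subseteq> J" for J
      by (rule transversal_maximal[OF two_label_transversal[OF X] indep_subtransversal[OF that(1)] that(2)])
    show "?S \<in> bases (delete Z (T_set E t 3))"
      unfolding bases_def delete_def multimatroid.simps
    proof (intro CollectI conjI ballI impI)
      show "J = ?S" if "J \<in> {I \<in> indep Z. I \<subseteq> multimatroid.carrier Z - T_set E t 3}" "?S \<subseteq> J" for J
        using that by (intro max) simp_all
    qed (fact S avoid)+
  qed
  then show ?thesis by (auto simp: D_of_def)
qed

text \<open>
  Tightness as a linear relation: if one of the three transversals is a basis, exactly one of them is
  not, so the number of bases among them is always even. It plays the part of additivity of
  the determinant in a column, the column of \<open>e\<^sub>3\<close> being the sum of those of \<open>e\<^sub>1\<close> and \<open>e\<^sub>2\<close>.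
\<close>

lemma indep_third_iff:
  assumes tight: "tight_three_matroid Z" and T: "transversal U \<Omega> T" and e: "e \<in> E"
  shows "insert (t 3 e) (T - skew_class t e) \<in> indep Z \<longleftrightarrow>
    (insert (t 1 e) (T - skew_class t e) \<in> indep Z) \<noteq> (insert (t 2 e) (T - skew_class t e) \<in> indep Z)"
proof -
  let ?T = "\<lambda>u. insert u (T - skew_class t e)"
  have sk: "t 1 e \<in> skew_class t e" "t 2 e \<in> skew_class t e" "t 3 e \<in> skew_class t e"
    by (simp_all add: skew_class_def)
  have base: "?T u \<in> bases Z \<longleftrightarrow> ?T u \<in> indep Z" if "u \<in> skew_class t e" for u
    using transversal_exchange[OF T e that] by (simp add: bases_iff)
  have uniq: "\<exists>!v. v \<in> skew_class t e \<and> ?T v \<notin> indep Z" if u: "u \<in> skew_class t e" "?T u \<in> indep Z" for u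
  proof -
    have "?T u \<in> bases Z" using u base by blast
    then have "\<exists>!v. v \<in> skew_class t e \<and> (?T u - skew_class t e) \<union> {v} \<notin> bases Z"
      using tight e unfolding tight_three_matroid_def classes_Z by blast
    moreover have "(?T u - skew_class t e) \<union> {v} = ?T v" for v using u(1) by blast
    ultimately show ?thesis using base by (metis (no_types, lifting))
  qed
  have ne: "t 1 e \<noteq> t 2 e" "t 1 e \<noteq> t 3 e" "t 2 e \<noteq> t 3 e" using e by simp_all
  have cls: "v = t 1 e \<or> v = t 2 e \<or> v = t 3 e" if "v \<in> skew_class t e" for v
    using that by (simp add: skew_class_def)
  show ?thesis
  proof (cases "\<exists>u\<in>skew_class t e. ?T u \<in> indep Z")
    case True
    then have "\<exists>!v. v \<in> skew_class t e \<and> ?T v \<notin> indep Z" using uniq by blast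
    then show ?thesis using sk ne cls by metis
  next
    case False
    then show ?thesis using sk by blast
  qed
qed

end

text \<open>
  The bases avoiding \<open>T\<^sub>3\<close> are read off from the delta-matroid; the others are reached by induction on
  the number of elements of \<open>T\<^sub>3\<close>, using the parity relation in a class where the transversal contains
  \<open>e\<^sub>3\<close>. Independent sets are the subsets of bases.
\<close>

lemma (in labelled_carrier) tight_three_matroid_unique:
  assumes Z: "tight_three_matroid Z" "multimatroid.carrier Z = U" "skew_classes Z = \<Omega>"
    and Z': "tight_three_matroid Z'" "multimatroid.carrier Z' = U" "skew_classes Z' = \<Omega>"
    and D: "D_of E t Z = D_of E t Z'"
  shows "Z = Z'"
proof -
  interpret Z: three_matroid_on_carrier E t Z
    using Z by unfold_locales (simp_all add: tight_three_matroid_def)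
  interpret Z': three_matroid_on_carrier E t Z'
    using Z' by unfold_locales (simp_all add: tight_three_matroid_def)
  have same: "T \<in> indep Z \<longleftrightarrow> T \<in> indep Z'" if "transversal U \<Omega> T" "card (T \<inter> T_set E t 3) = n" for T n
    using that
  proof (induction n arbitrary: T)
    case 0
    have "finite T" using 0 finite_subtransversal by (simp add: transversal_iff)
    then have "T \<inter> T_set E t 3 = {}" using 0 by simp
    from transversal_avoiding_third[OF 0(1) this]
    have T: "T = t 1 ` (E - {e \<in> E. t 2 e \<in> T}) \<union> t 2 ` {e \<in> E. t 2 e \<in> T}" .
    have "{e \<in> E. t 2 e \<in> T} \<in> members (D_of E t Z) \<longleftrightarrow> {e \<in> E. t 2 e \<in> T} \<in> members (D_of E t Z')"
      by (simp only: D)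
    then show ?case
      unfolding Z.members_D_of_iff Z'.members_D_of_iff T[symmetric] by simp
  next
    case (Suc n)
    then have "T \<inter> T_set E t 3 \<noteq> {}" by (metis card.empty nat.simps(3))
    then obtain e where e: "e \<in> E" "t 3 e \<in> T" unfolding T_set_def by blast
    have sk: "t 3 e \<in> skew_class t e" by (simp add: skew_class_def)
    have "T \<inter> skew_class t e = {t 3 e}"
      using subtransversalD[OF transversalD(1)[OF Suc.prems(1)] e(1) _ sk _ e(2)] e(2) sk by blast
    then have T: "insert (t 3 e) (T - skew_class t e) = T" by blast
    have IH: "insert (t i e) (T - skew_class t e) \<in> indep Z \<longleftrightarrow>
        insert (t i e) (T - skew_class t e) \<in> indep Z'" if i: "i \<in> {1, 2}" for i
    proof (rule Suc.IH)
      have ti: "t i e \<in> skew_class t e" using i by (auto simp: skew_class_def)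
      then show "transversal U \<Omega> (insert (t i e) (T - skew_class t e))"
        by (rule transversal_exchange[OF Suc.prems(1) e(1)])
      have "t i e \<notin> T_set E t 3" using i e(1) by (auto simp: T_set_def)
      moreover have "skew_class t e \<inter> T_set E t 3 = {t 3 e}"
        using e(1) by (auto simp: T_set_def skew_class_def)
      moreover have "insert (t i e) (T - skew_class t e) \<inter> T_set E t 3 =
          T \<inter> T_set E t 3 - skew_class t e \<inter> T_set E t 3"
        using \<open>t i e \<notin> T_set E t 3\<close> by blast
      ultimately have "insert (t i e) (T - skew_class t e) \<inter> T_set E t 3 = T \<inter> T_set E t 3 - {t 3 e}"
        by simp
      moreover have "t 3 e \<in> T \<inter> T_set E t 3" using e by (simp add: T_set_def)
      ultimately show "card (insert (t i e) (T - skew_class t e) \<inter> T_set E t 3) = n"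
        using Suc.prems(2) by (simp add: card_Diff_singleton)
    qed
    show ?case
      using Z.indep_third_iff[OF Z(1) Suc.prems(1) e(1)] Z'.indep_third_iff[OF Z'(1) Suc.prems(1) e(1)]
        IH[of 1] IH[of 2] unfolding T by simp
  qed
  have "I \<in> indep Z \<longleftrightarrow> I \<in> indep Z'" for I
    unfolding Z.indep_iff[of I] Z'.indep_iff[of I] using same by blast
  then have "indep Z = indep Z'" by blast
  then show ?thesis using Z Z' by simp
qed

section \<open>The tight 3-matroid of a Lagrangian subspace\<close>

locale labelled_lagrangian = labelled_carrier E t + lagrangian E L
  for E :: "'a set" and t :: "nat \<Rightarrow> 'a \<Rightarrow> 'b" and L :: "('a set \<times> 'a set) set"
begin

text \<open>
  The two coordinates of the vector of \<open>C\<close>. The element \<open>e\<^sub>3\<close> counts in both coordinates, and elements of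
  one class are added, so that the coordinates are additive on arbitrary sets of elements; a whole
  skew class has the zero vector.
\<close>

definition P_part :: "'b set \<Rightarrow> 'a set" where
  "P_part C = {e \<in> E. (t 1 e \<in> C) \<noteq> (t 3 e \<in> C)}"

definition Q_part :: "'b set \<Rightarrow> 'a set" where
  "Q_part C = {e \<in> E. (t 2 e \<in> C) \<noteq> (t 3 e \<in> C)}"

lemma parts_sym_diff:
  "P_part (A \<triangle> B) = P_part A \<triangle> P_part B" "Q_part (A \<triangle> B) = Q_part A \<triangle> Q_part B"
  by (auto simp: P_part_def Q_part_def)

lemma parts_subset: "P_part A \<subseteq> E" "Q_part A \<subseteq> E"
  by (auto simp: P_part_def Q_part_def)

definition dependencies :: "'b set set" where
  "dependencies = {C. C \<subseteq> U \<and> (P_part C, Q_part C) \<in> L}"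

lemma dependencies_zero: "{} \<in> dependencies"
  using L_zero by (simp add: dependencies_def P_part_def Q_part_def)

lemma dependencies_add: "A \<in> dependencies \<Longrightarrow> B \<in> dependencies \<Longrightarrow> A \<triangle> B \<in> dependencies"
  by (simp add: dependencies_def parts_sym_diff L_add sym_diff_subset)

lemma skew_class_dependency: "e \<in> E \<Longrightarrow> skew_class t e \<in> dependencies"
proof -
  assume e: "e \<in> E"
  have "P_part (skew_class t e) = {}" "Q_part (skew_class t e) = {}"
    using e by (auto simp: P_part_def Q_part_def skew_class_def)
  then show ?thesis using L_zero e by (auto simp: dependencies_def)
qed

lemma subtransversal_parts_empty:
  assumes C: "subtransversal U \<Omega> C" and e: "P_part C = {}" "Q_part C = {}"
  shows "C = {}"
proof (rule ccontr)
  assume "C \<noteq> {}"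
  then obtain x f where x: "x \<in> C" "f \<in> E" "x \<in> skew_class t f"
    using C unfolding subtransversal_def by blast
  have "t 1 f \<in> C \<longleftrightarrow> t 3 f \<in> C" "t 2 f \<in> C \<longleftrightarrow> t 3 f \<in> C"
    using e x(2) by (auto simp: P_part_def Q_part_def)
  then have "t 1 f \<in> C" "t 3 f \<in> C" using x by (auto simp: skew_class_def)
  then have "t 1 f = t 3 f"
    by (intro subtransversalD[OF C x(2)]) (simp_all add: skew_class_def)
  then show False using x(2) by simp
qed

text \<open>
  For the graph of a symmetric matrix \<open>A\<close> this is independence of columns of the matrix
  \<open>(I | A | I + A)\<close>, with \<open>e\<^sub>1\<close>, \<open>e\<^sub>2\<close>, \<open>e\<^sub>3\<close> labelling the three columns of \<open>e\<close>.
\<close>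

definition Z_of :: "'b multimatroid" where
  "Z_of = \<lparr>multimatroid.carrier = U, skew_classes = \<Omega>,
    indep = {I. subtransversal U \<Omega> I \<and> (\<forall>C\<in>dependencies. C \<subseteq> I \<longrightarrow> C = {})}\<rparr>"

lemma Z_of_simps [simp]: "multimatroid.carrier Z_of = U" "skew_classes Z_of = \<Omega>"
  by (simp_all add: Z_of_def)

lemma indep_Z_of_iff:
  "I \<in> indep Z_of \<longleftrightarrow> subtransversal U \<Omega> I \<and> (\<forall>C\<in>dependencies. C \<subseteq> I \<longrightarrow> C = {})"
  by (simp add: Z_of_def)

text \<open>
  If both insertions created dependencies \<open>A\<close> through \<open>x\<close> and \<open>B\<close> through \<open>y\<close>, these would agree wherever
  both are nonzero except in the class of \<open>e\<close>, where they have different nonzero entries. Their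
  symplectic product would be 1, against isotropy.
\<close>

lemma Z_of_insert:
  assumes I: "I \<in> indep Z_of" and e: "e \<in> E" "skew_class t e \<inter> I = {}"
    and xy: "x \<in> skew_class t e" "y \<in> skew_class t e" "x \<noteq> y"
  shows "insert x I \<in> indep Z_of \<or> insert y I \<in> indep Z_of"
proof (rule ccontr)
  have sub: "subtransversal U \<Omega> I" and free: "\<And>C. C \<in> dependencies \<Longrightarrow> C \<subseteq> I \<Longrightarrow> C = {}"
    using I by (auto simp: indep_Z_of_iff)
  assume *: "\<not> (insert x I \<in> indep Z_of \<or> insert y I \<in> indep Z_of)"
  have "\<exists>C\<in>dependencies. C \<subseteq> insert u I \<and> u \<in> C" if "u \<in> skew_class t e" "insert u I \<notin> indep Z_of" for u
    using that subtransversal_insert[OF sub e that(1)] free unfolding indep_Z_of_iff by blast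
  then obtain A B where A: "A \<in> dependencies" "A \<subseteq> insert x I" "x \<in> A"
    and B: "B \<in> dependencies" "B \<subseteq> insert y I" "y \<in> B" using xy * by metis
  have outside: "f \<in> P_part A \<inter> Q_part B \<longleftrightarrow> f \<in> Q_part A \<inter> P_part B" if f: "f \<in> E" "f \<noteq> e" for f
  proof -
    have "x \<notin> skew_class t f" "y \<notin> skew_class t f"
      using skew_class_disjoint[OF f(1) e(1)] xy f(2) by blast+
    then have "u \<in> I" if "u \<in> skew_class t f" "u \<in> A \<or> u \<in> B" for u using A(2) B(2) that by blast
    then have "u = v" if "u \<in> skew_class t f" "v \<in> skew_class t f" "u \<in> A \<or> u \<in> B" "v \<in> A \<or> v \<in> B" for u v
      using subtransversalD[OF sub f(1)] that by blast
    from this[of "t 1 f" "t 2 f"] this[of "t 1 f" "t 3 f"] this[of "t 2 f" "t 3 f"] f(1)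
    show ?thesis by (auto simp: P_part_def Q_part_def skew_class_def)
  qed
  have "e \<in> (P_part A \<inter> Q_part B) \<triangle> (Q_part A \<inter> P_part B)"
  proof -
    have "u \<in> A \<longleftrightarrow> u = x" "u \<in> B \<longleftrightarrow> u = y" if "u \<in> skew_class t e" for u
      using A(2,3) B(2,3) e(2) that by blast+
    then have "t 1 e \<in> A \<longleftrightarrow> t 1 e = x" "t 2 e \<in> A \<longleftrightarrow> t 2 e = x" "t 3 e \<in> A \<longleftrightarrow> t 3 e = x"
      "t 1 e \<in> B \<longleftrightarrow> t 1 e = y" "t 2 e \<in> B \<longleftrightarrow> t 2 e = y" "t 3 e \<in> B \<longleftrightarrow> t 3 e = y"
      by (simp_all add: skew_class_def)
    then show ?thesis
      using xy e(1) by (auto simp: P_part_def Q_part_def skew_class_def)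
  qed
  moreover have "f = e" if f: "f \<in> (P_part A \<inter> Q_part B) \<triangle> (Q_part A \<inter> P_part B)" for f
  proof (rule ccontr)
    assume "f \<noteq> e"
    moreover have "f \<in> E" using f parts_subset[of A] by auto
    ultimately show False using outside f unfolding in_sym_diff by blast
  qed
  ultimately have "(P_part A \<inter> Q_part B) \<triangle> (Q_part A \<inter> P_part B) = {e}" by blast
  then show False
    using L_isotropic[of "P_part A" "Q_part A" "P_part B" "Q_part B"] A(1) B(1)
    by (simp add: dependencies_def)
qed

lemma matroid_Z_of:
  assumes T: "transversal U \<Omega> T"
  shows "matroid \<lparr>ground = T, members = indep Z_of \<inter> Pow T\<rparr>"
proof -
  have subT: "subtransversal U \<Omega> T" using T by (simp add: transversal_iff)
  then have fin: "finite T" by (rule finite_subtransversal)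
  have mem: "I \<in> indep Z_of \<inter> Pow T \<longleftrightarrow> I \<subseteq> T \<and> (\<forall>C\<in>dependencies. C \<subseteq> I \<longrightarrow> C = {})" for I
    using subtransversal_subset[OF subT] by (auto simp: indep_Z_of_iff)
  have exchange: "\<exists>x\<in>J - I. insert x I \<in> indep Z_of \<inter> Pow T"
    if "I \<in> indep Z_of \<inter> Pow T" "J \<in> indep Z_of \<inter> Pow T" "card I < card J" for I J
  proof -
    have IJ: "I \<subseteq> T" "J \<subseteq> T" and free: "\<forall>C\<in>dependencies. C \<subseteq> I \<longrightarrow> C = {}"
      "\<forall>C\<in>dependencies. C \<subseteq> J \<longrightarrow> C = {}"
      using that(1,2) unfolding mem by blast+
    have "finite I" "finite J" using IJ fin finite_subset by blast+
    from binary_exchange[OF dependencies_zero dependencies_add this that(3) free]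
    obtain x where "x \<in> J - I" "\<forall>C\<in>dependencies. C \<subseteq> insert x I \<longrightarrow> C = {}" by blast
    then show ?thesis using IJ unfolding mem by blast
  qed
  have empty: "{} \<in> indep Z_of \<inter> Pow T" unfolding mem by blast
  have down: "I \<in> indep Z_of \<inter> Pow T" if "J \<in> indep Z_of \<inter> Pow T" "I \<subseteq> J" for I J
    using that unfolding mem by blast
  show ?thesis
    unfolding matroid_def set_system_def set_system.simps
    using fin empty down exchange by (intro conjI ballI allI impI) (assumption | blast)+
qed

lemma multimatroid_Z_of: "multimatroid Z_of"
  unfolding multimatroid_def Z_of_simps
proof (intro conjI ballI allI impI)
  fix \<omega> I x y
  assume *: "I \<in> indep Z_of" "\<omega> \<in> \<Omega>" "\<omega> \<inter> I = {}" "x \<in> \<omega>" "y \<in> \<omega>" "x \<noteq> y"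
  from *(2) obtain e where "e \<in> E" "\<omega> = skew_class t e" by blast
  then show "insert x I \<in> indep Z_of \<or> insert y I \<in> indep Z_of"
    using Z_of_insert[of I e x y] * by blast
qed (use finite_U partition_on_skew_classes matroid_Z_of in \<open>auto simp: indep_Z_of_iff\<close>)

sublocale Z_of: three_matroid_on_carrier E t Z_of
  by unfold_locales (use multimatroid_Z_of card_skew_class in \<open>auto simp: three_matroid_def\<close>)

lemma card_transversal:
  assumes T: "transversal U \<Omega> T"
  shows "card T = card E"
proof -
  have "T = (\<Union>e\<in>E. T \<inter> skew_class t e)" using T by (auto simp: transversal_def)
  also have "card \<dots> = (\<Sum>e\<in>E. card (T \<inter> skew_class t e))"
    using finite_ground finite_skew_class skew_class_disjoint by (intro card_UN_disjoint) blast+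
  also have "\<dots> = (\<Sum>e\<in>E. 1)"
    using T by (intro sum.cong) (simp_all add: transversal_def)
  finally show ?thesis by simp
qed

text \<open>
  With two elements of the class added to the rest of the transversal there are \<open>|E| + 1\<close> elements,
  which have more subsets than \<open>L\<close> has cosets; hence they contain a nonempty dependency. If it uses
  both \<open>e\<^sub>1\<close> and \<open>e\<^sub>2\<close>, adding the class itself, a vector zero, replaces them by \<open>e\<^sub>3\<close>.
\<close>

lemma dependency_through_class:
  assumes T: "transversal U \<Omega> T" and e: "e \<in> E"
    and indep: "T - skew_class t e \<in> indep Z_of"
  shows "\<exists>u\<in>skew_class t e. insert u (T - skew_class t e) \<notin> indep Z_of"
proof -
  let ?I = "T - skew_class t e"
  let ?S = "?I \<union> {t 1 e, t 2 e}"
  have free: "\<And>C. C \<in> dependencies \<Longrightarrow> C \<subseteq> ?I \<Longrightarrow> C = {}" and sub: "subtransversal U \<Omega> ?I"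
    using indep by (auto simp: indep_Z_of_iff)
  have fin: "finite ?I" using sub by (rule finite_subtransversal)
  have sk: "t 1 e \<in> skew_class t e" "t 2 e \<in> skew_class t e" "t 3 e \<in> skew_class t e"
    by (simp_all add: skew_class_def)
  have "card (T \<inter> skew_class t e) = 1" using T e by (simp add: transversal_def)
  then have "card ?I + 1 = card E"
    using card_transversal[OF T] card_Diff_subset_Int[of T "skew_class t e"] fin
      finite_subtransversal[of T] T e finite_ground
    by (metis (no_types, lifting) add.commute card_Int_Diff card_Diff_subset_Int transversal_iff)
  moreover have "card ?S = card ?I + 2"
    using fin sk e by (subst card_Un_disjoint) auto
  ultimately have "card ?S = Suc (card E)" by linarith
  moreover have "finite ?S" using fin by simp
  ultimately have "card (Pow ?S) = 2 ^ Suc (card E)" by (simp only: card_Pow)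
  then have "card (Pow ?S) > 2 ^ card E" by simp
  then obtain A B where AB: "A \<in> Pow ?S" "B \<in> Pow ?S" "A \<noteq> B"
    "(P_part A \<triangle> P_part B, Q_part A \<triangle> Q_part B) \<in> L"
    by (rule two_vectors_differ_in_L[of "Pow ?S" P_part Q_part, rotated 2])
      (use fin parts_subset in auto)
  define C where "C = A \<triangle> B"
  have "C \<subseteq> ?S" using AB(1,2) unfolding C_def by (intro sym_diff_subset) simp_all
  moreover have "C \<noteq> {}" using AB(3) by (auto simp: C_def sym_diff_set_def)
  ultimately have C: "C \<subseteq> ?S" "C \<noteq> {}" .
  have "?S \<subseteq> U" using sub sk e unfolding subtransversal_def by blast
  then have dep: "C \<in> dependencies"
    using AB(4) C(1) by (simp only: dependencies_def mem_Collect_eq C_def parts_sym_diff) blast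
  consider "t 1 e \<in> C" "t 2 e \<notin> C" | "t 1 e \<notin> C" "t 2 e \<in> C" | "t 1 e \<in> C" "t 2 e \<in> C" | "t 1 e \<notin> C" "t 2 e \<notin> C"
    by blast
  then have "\<exists>u\<in>skew_class t e. \<exists>C\<in>dependencies. C \<subseteq> insert u ?I \<and> C \<noteq> {}"
  proof cases
    case 1
    then have "C \<subseteq> insert (t 1 e) ?I" using C(1) by blast
    then show ?thesis using dep C(2) sk by blast
  next
    case 2
    then have "C \<subseteq> insert (t 2 e) ?I" using C(1) by blast
    then show ?thesis using dep C(2) sk by blast
  next
    case 3
    have "t 3 e \<notin> C" using C(1) sk e by auto
    then have "C \<triangle> skew_class t e \<subseteq> insert (t 3 e) ?I" "t 3 e \<in> C \<triangle> skew_class t e"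
      using 3 C(1) by (auto simp: skew_class_def)
    moreover have "C \<triangle> skew_class t e \<in> dependencies"
      using dep skew_class_dependency[OF e] by (rule dependencies_add)
    ultimately show ?thesis using sk by blast
  next
    case 4
    then have "C \<subseteq> ?I" using C(1) by blast
    then show ?thesis using free[OF dep] C(2) by blast
  qed
  then show ?thesis unfolding indep_Z_of_iff by blast
qed

text \<open>
  A non-basis in each class exists by the counting argument and is unique by isotropy.
\<close>

lemma tight_Z_of: "tight_three_matroid Z_of"
  unfolding tight_three_matroid_def
proof (intro conjI ballI)
  fix B \<omega> assume "B \<in> bases Z_of" "\<omega> \<in> skew_classes Z_of"
  then obtain e where B: "B \<in> indep Z_of" "transversal U \<Omega> B" and e: "e \<in> E" "\<omega> = skew_class t e"
    by (auto simp: Z_of.bases_iff)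
  let ?I = "B - \<omega>"
  have base: "?I \<union> {u} \<in> bases Z_of \<longleftrightarrow> insert u ?I \<in> indep Z_of" if "u \<in> \<omega>" for u
    using transversal_exchange[OF B(2) e(1), of u] that by (simp add: Z_of.bases_iff e(2))
  have I: "?I \<in> indep Z_of" using Z_of.indep_subset[OF B(2,1)] by blast
  then obtain u where u: "u \<in> \<omega>" "insert u ?I \<notin> indep Z_of"
    using dependency_through_class[OF B(2) e(1)] unfolding e(2) by blast
  have "v = u" if v: "v \<in> \<omega>" "insert v ?I \<notin> indep Z_of" for v
    using Z_of_insert[OF I e(1), of u v] u v unfolding e(2) by blast
  then show "\<exists>!u. u \<in> \<omega> \<and> ?I \<union> {u} \<notin> bases Z_of"
    using u base by blast
qed (rule Z_of.three_matroid)

text \<open>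
  The vectors below the transversal with \<open>e\<^sub>2\<close> on \<open>X\<close> and \<open>e\<^sub>1\<close> elsewhere are the pairs \<open>(p, q)\<close> with
  \<open>p \<subseteq> E - X\<close> and \<open>q \<subseteq> X\<close>, which are the ones in the definition of feasibility.
\<close>

lemma two_label_indep_iff:
  assumes X: "X \<subseteq> E"
  shows "t 1 ` (E - X) \<union> t 2 ` X \<in> indep Z_of \<longleftrightarrow> feasible X" (is "?S \<in> _ \<longleftrightarrow> _")
proof
  have XE: "\<And>e. e \<in> X \<Longrightarrow> e \<in> E" using X by blast
  have sub: "subtransversal U \<Omega> ?S" using two_label_transversal[OF X] by (simp add: transversal_iff)
  {
    assume S: "?S \<in> indep Z_of"
    show "feasible X"
    proof (rule feasibleI[OF X])
      fix p q assume pq: "(p, q) \<in> L" "p \<inter> X = {}" "q \<subseteq> X"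
      have pE: "p \<subseteq> E" using pq(1) L_subset by blast
      let ?C = "t 1 ` p \<union> t 2 ` q"
      have E: "\<And>e. e \<in> p \<Longrightarrow> e \<in> E" "\<And>e. e \<in> q \<Longrightarrow> e \<in> E" using pE pq(3) X by blast+
      have CS: "?C \<subseteq> ?S" using pE pq by blast
      have "P_part ?C = p" "Q_part ?C = q"
        using E by (auto simp: P_part_def Q_part_def image_iff)
      moreover have "?C \<subseteq> U"
        using subtransversal_subset[OF sub CS] by (simp only: subtransversal_def)
      ultimately have dep: "?C \<in> dependencies" using pq(1) by (simp only: dependencies_def mem_Collect_eq)
      have "?C = {}" using S dep CS by (simp only: indep_Z_of_iff)
      then show "p = {} \<and> q = {}" by simp
    qed
  }
  assume F: "feasible X"
  have "C = {}" if C: "C \<in> dependencies" "C \<subseteq> ?S" for C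
  proof -
    have no: "t 3 e \<notin> C" "t 1 e \<in> C \<Longrightarrow> e \<notin> X" "t 2 e \<in> C \<Longrightarrow> e \<in> X" if "e \<in> E" for e
      using C(2) that XE by auto
    have "P_part C \<inter> X = {}" "Q_part C \<subseteq> X" using no by (auto simp: P_part_def Q_part_def)
    then have "P_part C = {} \<and> Q_part C = {}"
      using feasibleD[OF F] C(1) unfolding dependencies_def by blast
    then show ?thesis using subtransversal_parts_empty subtransversal_subset[OF sub C(2)] by blast
  qed
  then show "?S \<in> indep Z_of" using sub by (auto simp: indep_Z_of_iff)
qed

text \<open>
  The definite description is resolved by existence (\<open>tight_Z_of\<close>) together with uniqueness
  (\<open>tight_three_matroid_unique\<close>).
\<close>

lemma Z3_eq_Z_of:
  fixes D :: "'a set_system"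
  assumes D: "ground D = E" "members D = Collect feasible"
  shows "Z3 D t = Z_of"
proof -
  have "X \<in> members (D_of E t Z_of) \<longleftrightarrow> feasible X" for X
    using two_label_indep_iff[of X] by (auto simp: Z_of.members_D_of_iff dest: feasible_subset)
  then have "members (D_of E t Z_of) = members D" by (simp add: D(2) set_eq_iff)
  then have DZ: "D_of E t Z_of = D" using D by (simp add: D_of_def)
  show ?thesis
    unfolding Z3_def D(1)
  proof (rule the_equality)
    show "tight_three_matroid Z_of \<and> multimatroid.carrier Z_of = U \<and> skew_classes Z_of = \<Omega> \<and>
        D_of E t Z_of = D"
      using tight_Z_of DZ by simp
  next
    fix Z assume "tight_three_matroid Z \<and> multimatroid.carrier Z = U \<and> skew_classes Z = \<Omega> \<and>
        D_of E t Z = D"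
    then show "Z = Z_of" using tight_three_matroid_unique tight_Z_of DZ by simp
  qed
qed

text \<open>
  A subtransversal contains at most one of \<open>e\<^sub>2\<close> and \<open>e\<^sub>3\<close>, and it has second coordinate 1 at \<open>e\<close> exactly if
  it contains one of them.
\<close>

lemma card_Int_T23:
  assumes C: "subtransversal U \<Omega> C"
  shows "card (C \<inter> (T_set E t 2 \<union> T_set E t 3)) = card (Q_part C)"
proof -
  let ?f = "\<lambda>e. if t 2 e \<in> C then t 2 e else t 3 e"
  have not_both: "\<not> (t 2 e \<in> C \<and> t 3 e \<in> C)" if "e \<in> E" for e
    using subtransversalD[OF C that, of "t 2 e" "t 3 e"] that by (auto simp: skew_class_def)
  have inj: "inj_on ?f (Q_part C)" by (auto simp: inj_on_def Q_part_def)
  have image: "?f ` Q_part C = C \<inter> (T_set E t 2 \<union> T_set E t 3)"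
  proof
    show "?f ` Q_part C \<subseteq> C \<inter> (T_set E t 2 \<union> T_set E t 3)"
      by (auto simp: Q_part_def T_set_def)
    show "C \<inter> (T_set E t 2 \<union> T_set E t 3) \<subseteq> ?f ` Q_part C"
      using not_both by (auto simp: Q_part_def T_set_def image_iff)
  qed
  show ?thesis using card_image[OF inj] unfolding image .
qed

text \<open>
  Circuits are minimal nonzero vectors of \<open>L\<close>, so their parities determine those of all vectors; every
  vector of \<open>L\<close> is the vector of a unique subtransversal.
\<close>

lemma circuits_even_iff:
  "(\<forall>C\<in>circuits Z_of. even (card (C \<inter> (T_set E t 2 \<union> T_set E t 3)))) \<longleftrightarrow>
    (\<forall>(p, q)\<in>L. even (card q))"
proof -
  define S where "S = {C. subtransversal U \<Omega> C}"
  define N where "N = dependencies \<inter> S"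
  define W where "W = T_set E t 2 \<union> T_set E t 3"
  have down: "B \<in> S" if "A \<in> S" "B \<subseteq> A" for A B
    using that subtransversal_subset by (simp add: S_def)
  have "circuits Z_of = {C \<in> S. C \<notin> indep Z_of \<and> (\<forall>C'\<in>S. C' \<subset> C \<longrightarrow> C' \<in> indep Z_of)}"
    unfolding circuits_def Z_of_simps S_def by blast
  also have "\<dots> = {A \<in> N. A \<noteq> {} \<and> (\<forall>B\<in>N. B \<subset> A \<longrightarrow> B = {})}"
  proof (rule minimal_dependent_eq_minimal_members[OF down])
    show "N \<subseteq> S" by (simp add: N_def)
    show "I \<in> indep Z_of \<longleftrightarrow> (\<forall>A\<in>N. A \<subseteq> I \<longrightarrow> A = {})" if "I \<in> S" for I
      using that down unfolding indep_Z_of_iff N_def S_def by blast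
  qed
  finally have circ: "circuits Z_of = \<dots>" .
  have fin: "finite A" if "A \<in> N" for A
    using that finite_subtransversal by (simp add: N_def S_def)
  have diff: "A - B \<in> N" if "A \<in> N" "B \<in> N" "B \<subset> A" for A B
  proof -
    have "A \<triangle> B = A - B" using that(3) by (auto simp: sym_diff_set_def)
    then show ?thesis using dependencies_add[of A B] down[of A "A - B"] that by (simp add: N_def)
  qed
  have "(\<forall>C\<in>circuits Z_of. even (card (C \<inter> W))) \<longleftrightarrow>
      (\<forall>A\<in>N. A \<noteq> {} \<and> (\<forall>B\<in>N. B \<subset> A \<longrightarrow> B = {}) \<longrightarrow> even (card (A \<inter> W)))"
    unfolding circ by simp blast
  also have "\<dots> \<longleftrightarrow> (\<forall>A\<in>N. even (card (A \<inter> W)))"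
    using fin diff by (rule minimal_members_even_iff)
  also have "\<dots> \<longleftrightarrow> (\<forall>A\<in>N. even (card (Q_part A)))"
    using card_Int_T23 by (simp add: N_def S_def W_def)
  also have "\<dots> \<longleftrightarrow> (\<forall>(p, q)\<in>L. even (card q))"
  proof
    assume even: "\<forall>A\<in>N. even (card (Q_part A))"
    show "\<forall>(p, q)\<in>L. even (card q)"
    proof clarify
      fix p q assume pq: "(p, q) \<in> L"
      then have pE: "p \<subseteq> E" "q \<subseteq> E" using L_subset by blast+
      then have E: "\<And>e. e \<in> p \<Longrightarrow> e \<in> E" "\<And>e. e \<in> q \<Longrightarrow> e \<in> E" by blast+
      let ?C = "t 1 ` (p - q) \<union> t 2 ` (q - p) \<union> t 3 ` (p \<inter> q)"
      have parts: "P_part ?C = p" "Q_part ?C = q"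
        using E by (auto simp: P_part_def Q_part_def image_iff)
      have CU: "?C \<subseteq> U" using E by (auto simp: skew_class_def)
      then have "subtransversal U \<Omega> ?C"
        unfolding subtransversal_iff using E by (auto simp: skew_class_def)
      then have "?C \<in> N" using CU pq by (simp add: N_def S_def dependencies_def parts)
      then show "even (card q)" using even parts(2) by metis
    qed
  next
    assume "\<forall>(p, q)\<in>L. even (card q)"
    then show "\<forall>A\<in>N. even (card (Q_part A))" unfolding N_def dependencies_def by blast
  qed
  finally show ?thesis by (simp only: W_def)
qed

end

lemma (in labelled_carrier) parity_sum_eq_0_iff:
  "parity E t 2 C + parity E t 3 C = 0 \<longleftrightarrow> even (card (C \<inter> (T_set E t 2 \<union> T_set E t 3)))"
proof -
  have "finite (T_set E t 2)" "finite (T_set E t 3)" using finite_ground by (simp_all add: T_set_def)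
  moreover have "T_set E t 2 \<inter> T_set E t 3 = {}" by (auto simp: T_set_def)
  ultimately have "card (C \<inter> (T_set E t 2 \<union> T_set E t 3)) =
      card (C \<inter> T_set E t 2) + card (C \<inter> T_set E t 3)"
    unfolding Int_Un_distrib by (intro card_Un_disjoint) auto
  then show ?thesis by (simp add: parity_def of_nat_bit_eq_0_iff flip: of_nat_add)
qed

theorem theorem3p5:
  fixes D :: "'a set_system" and t :: "nat \<Rightarrow> 'a \<Rightarrow> 'b" and Z :: "'b multimatroid"
  assumes "delta_matroid D" and "is_binary D"
    and "labelling (ground D) t"
    and "Z = Z3 D t"
  shows "(bipartite D \<longleftrightarrow>
            (\<forall>C\<in>circuits Z. even (card (C \<inter> (T_set (ground D) t 2 \<union> T_set (ground D) t 3)))))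
       \<and> (bipartite D \<longleftrightarrow>
            (\<forall>C\<in>circuits Z. parity (ground D) t 2 C + parity (ground D) t 3 C = 0))"
proof -
  obtain L where L: "lagrangian (ground D) L" "members D = Collect (lagrangian.feasible (ground D) L)"
    using assms(1,2) by (rule binary_lagrangian)
  interpret lagrangian "ground D" L by (rule L(1))
  interpret labelled_lagrangian "ground D" t L
    by unfold_locales (use finite_E assms(3) in auto)
  have "members D \<noteq> {}" using assms(1) by (simp add: delta_matroid_def)
  then have "bipartite D \<longleftrightarrow>
      (\<forall>C\<in>circuits Z. even (card (C \<inter> (T_set (ground D) t 2 \<union> T_set (ground D) t 3))))"
    using bipartite_iff_even_second[OF refl L(2)] circuits_even_iff
    by (simp add: assms(4) Z3_eq_Z_of[OF refl L(2)])
  then show ?thesis by (simp add: parity_sum_eq_0_iff)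
qed

end
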